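(* Let $k\ge0$ be an integer and let $\sigma\in\{0,1\}^{B_k}$ be an ergodic local configuration. Then for any $\delta>0$ there exists a constant $C>0$ such that, for all sufficiently large integers $\ell$, for any $j\in E_\ell(\delta)$ and any $a\in\{0,1\}^2$, $$\max_{x\in B_{\ell-(\log\ell)^2}}\Big|\pi^a_{\ell,j}\big(\eta_{|B_k(x)}=\sigma\big)-\pi_{\rho_\ell(j)}\big(\eta_{|B_k}=\sigma\big)\Big|\le\frac{C(\log\ell)^2}{\ell}.$$
   Context: For $x\in\mathbb{Z}$ and $r\ge 0$, $B_r(x)=\{z\in\mathbb{Z}:|z-x|\le r\}$ and $B_r=B_r(0)$. The event $\{\eta_{|B_k(x)}=\sigma\}$ means $\eta_{x+z}=\sigma_z$ for all $z\in B_k$. A configuration $\sigma\in\{0,1\}^B$ on a connected set $B\subset\mathbb{Z}$ is ergodic if $\sigma_x+\sigma_{x+1}\ge1$ whenever $x,x+1\in B$; $\mathcal{E}_B$ is the set of ergodic configurations on $B$. $E_\ell(\delta)$ is the set of integers $j$ with $(\ell+1)(1+\delta)\le j\le(2\ell+1)(1-\delta)$, and $\rho_\ell(j)=j/(2\ell+1)$. For $a=(a_1,a_2)\in\{0,1\}^2$, $$\mathcal{E}^a_{\ell,j}=\Big\{\eta\in\mathcal{E}_{B_\ell}:\ a_1+\eta_{-\ell}\ge1,\ a_2+\eta_\ell\ge1,\ \sum_{x\in B_\ell}\eta_x=j\Big\},$$ and $\pi^a_{\ell,j}$ is the uniform probability measure on $\mathcal{E}^a_{\ell,j}$. For $\rho\in(1/2,1)$,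 $\pi_\rho$ is the translation-invariant probability measure on $\{0,1\}^{\mathbb{Z}}$ such that for $m\ge1$ and $\sigma\in\{0,1\}^{\{1,\dots,m\}}$ with $p=\sum_x\sigma_x$, $$\pi_\rho(\eta_{|\{1,\dots,m\}}=\sigma)=\mathbf 1_{\{\sigma\text{ ergodic}\}}(1-\rho)\Big(\frac{1-\rho}{\rho}\Big)^{m-1-p}\Big(\frac{2\rho-1}{\rho}\Big)^{2p-m+1-\sigma_1-\sigma_m}.$$ *)

theory Defs
  imports "HOL-Probability.Probability"
begin

type_synonym config = "int \<Rightarrow> nat"

text \<open>The elements of \<open>{0,1}\<^sup>B\<close> are represented by the functions in
  \<open>B \<rightarrow>\<^sub>E {0, 1}\<close>, which are undefined outside \<open>B\<close>.\<close>

definition int_ball :: "int \<Rightarrow> real \<Rightarrow> int set" where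
  "int_ball x r = {z. real_of_int \<bar>z - x\<bar> \<le> r}"

definition ergodic :: "int set \<Rightarrow> config \<Rightarrow> bool" where
  "ergodic B \<sigma> \<longleftrightarrow> (\<forall>x. x \<in> B \<and> x + 1 \<in> B \<longrightarrow> \<sigma> x + \<sigma> (x + 1) \<ge> 1)"

definition ergodic_configs :: "int set \<Rightarrow> config set" where
  "ergodic_configs B = {\<sigma> \<in> B \<rightarrow>\<^sub>E {0, 1}. ergodic B \<sigma>}"

definition particle_numbers :: "real \<Rightarrow> nat \<Rightarrow> int set" where
  "particle_numbers \<delta> l = {j. (real l + 1) * (1 + \<delta>) \<le> real_of_int j \<and>
     real_of_int j \<le> (2 * real l + 1) * (1 - \<delta>)}"

definition particle_density :: "nat \<Rightarrow> int \<Rightarrow> real" where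
  "particle_density l j = real_of_int j / (2 * real l + 1)"

definition canonical_configs :: "nat \<times> nat \<Rightarrow> nat \<Rightarrow> int \<Rightarrow> config set" where
  "canonical_configs a l j =
     {\<eta> \<in> ergodic_configs (int_ball 0 (real l)).
        fst a + \<eta> (- int l) \<ge> 1 \<and> snd a + \<eta> (int l) \<ge> 1 \<and>
        (\<Sum>x\<in>int_ball 0 (real l). int (\<eta> x)) = j}"

text \<open>If \<^term>\<open>canonical_configs a l j\<close> is empty, there is no uniform measure and this is an
  unspecified probability measure. This does not happen for \<^term>\<open>j \<in> particle_numbers \<delta> l\<close>
  with \<open>\<delta> > 0\<close>, since then \<open>l + 1 \<le> j \<le> 2 * l + 1\<close>.\<close>

definition canonical_measure :: "nat \<times> nat \<Rightarrow> nat \<Rightarrow> int \<Rightarrow> config measure" where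
  "canonical_measure a l j = measure_pmf (pmf_of_set (canonical_configs a l j))"

definition local_pattern :: "nat \<Rightarrow> config \<Rightarrow> int \<Rightarrow> config \<Rightarrow> bool" where
  "local_pattern k \<sigma> x \<eta> \<longleftrightarrow> (\<forall>z\<in>int_ball 0 (real k). \<eta> (x + z) = \<sigma> z)"

definition config_space :: "config measure" where
  "config_space = Pi\<^sub>M UNIV (\<lambda>_. count_space {0, 1})"

text \<open>The exponents are integers: \<open>m - 1 - p\<close> equals \<open>-1\<close> if \<open>\<sigma>\<close> is identically \<open>1\<close>.\<close>

definition cylinder_prob :: "real \<Rightarrow> nat \<Rightarrow> config \<Rightarrow> real" where
  "cylinder_prob \<rho> m \<sigma> =
     (let p = (\<Sum>x\<in>{1..int m}. int (\<sigma> x)) in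
      if ergodic {1..int m} \<sigma>
      then (1 - \<rho>) * ((1 - \<rho>) / \<rho>) powi (int m - 1 - p)
             * ((2 * \<rho> - 1) / \<rho>) powi (2 * p - int m + 1 - int (\<sigma> 1) - int (\<sigma> (int m)))
      else 0)"

definition is_equilibrium :: "real \<Rightarrow> config measure \<Rightarrow> bool" where
  "is_equilibrium \<rho> M \<longleftrightarrow>
     prob_space M \<and> sets M = sets config_space \<and>
     (\<forall>y. distr M config_space (\<lambda>\<eta> x. \<eta> (x + y)) = M) \<and>
     (\<forall>m\<ge>1. \<forall>\<sigma>\<in>{1..int m} \<rightarrow>\<^sub>E {0, 1}.
        \<P>(\<eta> in M. restrict \<eta> {1..int m} = \<sigma>) = cylinder_prob \<rho> m \<sigma>)"

text \<open>The description is proper for \<open>1/2 < \<rho> < 1\<close>: see \<open>ex1_equilibrium\<close> below.\<close>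

definition equilibrium :: "real \<Rightarrow> config measure" where
  "equilibrium \<rho> = (THE M. is_equilibrium \<rho> M)"


subsection \<open>Existence and uniqueness of the equilibrium measure\<close>

definition weight :: "real \<Rightarrow> int \<Rightarrow> int \<Rightarrow> config \<Rightarrow> real" where
  "weight \<rho> a b \<sigma> =
     (if ergodic {a..b} \<sigma>
      then (1 - \<rho>) * ((1 - \<rho>) / \<rho>) powi (b - a - (\<Sum>x\<in>{a..b}. int (\<sigma> x)))
             * ((2 * \<rho> - 1) / \<rho>) powi
                 (2 * (\<Sum>x\<in>{a..b}. int (\<sigma> x)) - (b - a) - int (\<sigma> a) - int (\<sigma> b))
      else 0)"

lemma cylinder_prob_eq_weight: "cylinder_prob \<rho> m \<sigma> = weight \<rho> 1 (int m) \<sigma>"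
  by (simp add: cylinder_prob_def weight_def Let_def algebra_simps)

lemma ergodic_cong: "(\<And>x. x \<in> B \<Longrightarrow> \<sigma> x = \<tau> x) \<Longrightarrow> ergodic B \<sigma> = ergodic B \<tau>"
  by (auto simp: ergodic_def)

lemma weight_cong:
  assumes "a \<le> b" "\<And>x. x \<in> {a..b} \<Longrightarrow> \<sigma> x = \<tau> x"
  shows "weight \<rho> a b \<sigma> = weight \<rho> a b \<tau>"
proof -
  have "(\<Sum>x\<in>{a..b}. int (\<sigma> x)) = (\<Sum>x\<in>{a..b}. int (\<tau> x))"
    using assms by (intro sum.cong) auto
  moreover have "ergodic {a..b} \<sigma> = ergodic {a..b} \<tau>"
    using assms(2) by (rule ergodic_cong)
  moreover have "\<sigma> a = \<tau> a" "\<sigma> b = \<tau> b" using assms by auto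
  ultimately show ?thesis unfolding weight_def by simp
qed

lemma weight_shift: "weight \<rho> (a + y) (b + y) \<sigma> = weight \<rho> a b (\<lambda>x. \<sigma> (x + y))"
proof -
  have "(\<Sum>x\<in>{a+y..b+y}. int (\<sigma> x)) = (\<Sum>x\<in>{a..b}. int (\<sigma> (x + y)))"
    by (rule sum.reindex_bij_witness[of _ "\<lambda>x. x + y" "\<lambda>x. x - y"]) auto
  moreover have "ergodic {a+y..b+y} \<sigma> = ergodic {a..b} (\<lambda>x. \<sigma> (x + y))"
  proof
    assume "ergodic {a+y..b+y} \<sigma>"
    then have "x + y \<in> {a+y..b+y} \<and> x + y + 1 \<in> {a+y..b+y} \<longrightarrow> 1 \<le> \<sigma> (x + y) + \<sigma> (x + y + 1)" for x
      unfolding ergodic_def by blast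
    then show "ergodic {a..b} (\<lambda>x. \<sigma> (x + y))"
      by (auto simp: ergodic_def algebra_simps)
  next
    assume "ergodic {a..b} (\<lambda>x. \<sigma> (x + y))"
    then have "x - y \<in> {a..b} \<and> x - y + 1 \<in> {a..b} \<longrightarrow> 1 \<le> \<sigma> (x - y + y) + \<sigma> (x - y + 1 + y)" for x
      unfolding ergodic_def by blast
    then show "ergodic {a+y..b+y} \<sigma>"
      by (auto simp: ergodic_def algebra_simps)
  qed
  ultimately show ?thesis unfolding weight_def by simp
qed

lemma weight_reflect: "weight \<rho> (- b) (- a) (\<lambda>x. \<sigma> (- x)) = weight \<rho> a b \<sigma>"
proof -
  have "(\<Sum>x\<in>{-b..-a}. int (\<sigma> (- x))) = (\<Sum>x\<in>{a..b}. int (\<sigma> x))"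
    by (rule sum.reindex_bij_witness[of _ "\<lambda>x. - x" "\<lambda>x. - x"]) auto
  moreover have "ergodic {-b..-a} (\<lambda>x. \<sigma> (- x)) = ergodic {a..b} \<sigma>"
  proof
    assume "ergodic {-b..-a} (\<lambda>x. \<sigma> (- x))"
    then have "- x - 1 \<in> {-b..-a} \<and> - x - 1 + 1 \<in> {-b..-a} \<longrightarrow>
        1 \<le> \<sigma> (- (- x - 1)) + \<sigma> (- (- x - 1 + 1))" for x
      unfolding ergodic_def by blast
    then show "ergodic {a..b} \<sigma>"
      by (auto simp: ergodic_def algebra_simps)
  next
    assume "ergodic {a..b} \<sigma>"
    then have "- x - 1 \<in> {a..b} \<and> - x - 1 + 1 \<in> {a..b} \<longrightarrow>
        1 \<le> \<sigma> (- x - 1) + \<sigma> (- x - 1 + 1)" for x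
      unfolding ergodic_def by blast
    then show "ergodic {-b..-a} (\<lambda>x. \<sigma> (- x))"
      by (auto simp: ergodic_def algebra_simps)
  qed
  ultimately show ?thesis unfolding weight_def by (simp add: algebra_simps)
qed

lemma weight_nonneg: "1/2 < \<rho> \<Longrightarrow> \<rho> < 1 \<Longrightarrow> 0 \<le> weight \<rho> a b \<sigma>"
  by (simp add: weight_def)

lemma weight_right:
  assumes \<rho>: "1/2 < \<rho>" "\<rho> < 1" and ab: "a \<le> b" and \<sigma>: "\<sigma> b \<in> {0, 1}"
  shows "weight \<rho> a (b + 1) (\<sigma>(b + 1 := 0)) + weight \<rho> a (b + 1) (\<sigma>(b + 1 := 1)) = weight \<rho> a b \<sigma>"
proof -
  have I: "{a..b+1} = insert (b+1) {a..b}" using ab by auto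
  have s: "(\<Sum>x\<in>{a..b+1}. int ((\<sigma>(b + 1 := v)) x)) = (\<Sum>x\<in>{a..b}. int (\<sigma> x)) + int v" for v
    unfolding I by (subst sum.insert) auto
  have e: "ergodic {a..b+1} (\<sigma>(b + 1 := v)) \<longleftrightarrow> ergodic {a..b} \<sigma> \<and> \<sigma> b + v \<ge> 1" for v
  proof
    assume *: "ergodic {a..b+1} (\<sigma>(b + 1 := v))"
    have "ergodic {a..b} \<sigma>" unfolding ergodic_def
    proof safe
      fix x assume "x \<in> {a..b}" "x + 1 \<in> {a..b}"
      then show "1 \<le> \<sigma> x + \<sigma> (x + 1)"
        using *[unfolded ergodic_def, rule_format, of x] by auto
    qed
    then show "ergodic {a..b} \<sigma> \<and> \<sigma> b + v \<ge> 1"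
      using *[unfolded ergodic_def, rule_format, of b] ab by simp
  next
    assume *: "ergodic {a..b} \<sigma> \<and> \<sigma> b + v \<ge> 1"
    show "ergodic {a..b+1} (\<sigma>(b + 1 := v))" unfolding ergodic_def
    proof safe
      fix x assume "x \<in> {a..b+1}" "x + 1 \<in> {a..b+1}"
      then show "1 \<le> (\<sigma>(b + 1 := v)) x + (\<sigma>(b + 1 := v)) (x + 1)"
        using * by (cases "x = b") (auto simp: ergodic_def)
    qed
  qed
  let ?s = "\<Sum>x\<in>{a..b}. int (\<sigma> x)"
  define u where "u = (1 - \<rho>) / \<rho>"
  define v where "v = (2 * \<rho> - 1) / \<rho>"
  have uv: "u \<noteq> 0" "v \<noteq> 0" "u + v = 1"
    using \<rho> by (auto simp: u_def v_def field_simps)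
  show ?thesis
  proof (cases "ergodic {a..b} \<sigma>")
    case False
    then show ?thesis by (simp add: weight_def e)
  next
    case True
    show ?thesis
    proof (cases "\<sigma> b = 0")
      case t: True
      have "weight \<rho> a (b + 1) (\<sigma>(b + 1 := 0)) = 0" using t by (simp add: weight_def e)
      moreover have "weight \<rho> a (b + 1) (\<sigma>(b + 1 := 1)) = weight \<rho> a b \<sigma>"
        using t ab True unfolding weight_def e s by (simp add: algebra_simps)
      ultimately show ?thesis by simp
    next
      case False
      then have t: "\<sigma> b = 1" using \<sigma> by auto
      let ?e1 = "b - a - ?s" and ?e2 = "2 * ?s - (b - a) - int (\<sigma> a) - 1"
      have "weight \<rho> a (b + 1) (\<sigma>(b + 1 := 0)) = (1 - \<rho>) * u powi (?e1 + 1) * v powi ?e2"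
        using t ab True unfolding weight_def e s u_def[symmetric] v_def[symmetric]
        by (simp add: algebra_simps)
      moreover have "weight \<rho> a (b + 1) (\<sigma>(b + 1 := 1)) = (1 - \<rho>) * u powi ?e1 * v powi (?e2 + 1)"
        using t ab True unfolding weight_def e s u_def[symmetric] v_def[symmetric]
        by (simp add: algebra_simps)
      moreover have "weight \<rho> a b \<sigma> = (1 - \<rho>) * u powi ?e1 * v powi ?e2"
        using t True unfolding weight_def u_def[symmetric] v_def[symmetric] by simp
      moreover have "(1 - \<rho>) * u powi (?e1 + 1) * v powi ?e2 + (1 - \<rho>) * u powi ?e1 * v powi (?e2 + 1)
          = (u + v) * ((1 - \<rho>) * u powi ?e1 * v powi ?e2)"
        unfolding power_int_add_1[OF disjI1, OF uv(1)] power_int_add_1[OF disjI1, OF uv(2)]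
        by (simp only: distrib_right distrib_left mult_ac)
      ultimately show ?thesis using uv by simp
    qed
  qed
qed

lemma weight_left:
  assumes \<rho>: "1/2 < \<rho>" "\<rho> < 1" and ab: "a \<le> b" and \<sigma>: "\<sigma> a \<in> {0, 1}"
  shows "weight \<rho> (a - 1) b (\<sigma>(a - 1 := 0)) + weight \<rho> (a - 1) b (\<sigma>(a - 1 := 1)) = weight \<rho> a b \<sigma>"
proof -
  have *: "weight \<rho> (a - 1) b (\<sigma>(a - 1 := v)) = weight \<rho> (- b) (- a + 1) ((\<lambda>x. \<sigma> (- x))(- a + 1 := v))" for v
    using ab by (subst weight_reflect[symmetric]) (auto intro!: weight_cong)
  show ?thesis
    unfolding * using weight_right[OF \<rho>, of "- b" "- a" "\<lambda>x. \<sigma> (- x)"] ab \<sigma> weight_reflect[of \<rho> b a \<sigma>]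
    by simp
qed

lemma sum_PiE_insert:
  fixes f :: "config \<Rightarrow> real"
  assumes "finite S" "i \<notin> S"
  shows "(\<Sum>\<sigma>\<in>insert i S \<rightarrow>\<^sub>E {0, 1}. f \<sigma>) = (\<Sum>\<sigma>\<in>S \<rightarrow>\<^sub>E {0, 1}. f (\<sigma>(i := 0)) + f (\<sigma>(i := 1)))"
proof -
  have "(\<Sum>\<sigma>\<in>insert i S \<rightarrow>\<^sub>E {0, 1}. f \<sigma>)
      = (\<Sum>(y, g)\<in>{0, 1} \<times> (S \<rightarrow>\<^sub>E {0, 1}). f (g(i := y)))"
    unfolding PiE_insert_eq using assms
    by (subst sum.reindex[OF inj_combinator]) (auto simp: case_prod_unfold)
  also have "\<dots> = (\<Sum>y\<in>{0, 1}. \<Sum>g\<in>S \<rightarrow>\<^sub>E {0, 1}. f (g(i := y)))"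
    by (rule sum.cartesian_product[symmetric])
  finally show ?thesis by (simp add: sum.distrib)
qed

lemma weight_single: "1/2 < \<rho> \<Longrightarrow> \<rho> < 1 \<Longrightarrow> (\<Sum>\<sigma>\<in>{a..a} \<rightarrow>\<^sub>E {0, 1}. weight \<rho> a a \<sigma>) = 1"
  using sum_PiE_insert[of "{}" a "weight \<rho> a a"]
  by (simp add: weight_def ergodic_def power_int_minus field_simps)

lemma weight_sum:
  assumes \<rho>: "1/2 < \<rho>" "\<rho> < 1" and ab: "a \<le> b"
  shows "(\<Sum>\<sigma>\<in>{a..b} \<rightarrow>\<^sub>E {0, 1}. weight \<rho> a b \<sigma>) = 1"
  using ab
proof (induction b rule: int_ge_induct)
  case base
  show ?case using weight_single[OF \<rho>] .
next
  case (step b)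
  have I: "{a..b+1} = insert (b+1) {a..b}" using step by auto
  have "(\<Sum>\<sigma>\<in>{a..b+1} \<rightarrow>\<^sub>E {0, 1}. weight \<rho> a (b+1) \<sigma>) = (\<Sum>\<sigma>\<in>{a..b} \<rightarrow>\<^sub>E {0, 1}. weight \<rho> a b \<sigma>)"
  proof -
    have "(\<Sum>\<sigma>\<in>insert (b+1) {a..b} \<rightarrow>\<^sub>E {0, 1}. weight \<rho> a (b+1) \<sigma>)
        = (\<Sum>\<sigma>\<in>{a..b} \<rightarrow>\<^sub>E {0, 1}. weight \<rho> a (b+1) (\<sigma>(b+1 := 0)) + weight \<rho> a (b+1) (\<sigma>(b+1 := 1)))"
      by (rule sum_PiE_insert) auto
    also have "\<dots> = (\<Sum>\<sigma>\<in>{a..b} \<rightarrow>\<^sub>E {0, 1}. weight \<rho> a b \<sigma>)"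
    proof (rule sum.cong[OF refl])
      fix \<sigma> :: config assume "\<sigma> \<in> {a..b} \<rightarrow>\<^sub>E {0, 1}"
      then have "\<sigma> b \<in> {0, 1}" by (rule PiE_mem) (use step(1) in simp)
      then show "weight \<rho> a (b+1) (\<sigma>(b+1 := 0)) + weight \<rho> a (b+1) (\<sigma>(b+1 := 1)) = weight \<rho> a b \<sigma>"
        by (rule weight_right[OF \<rho> step(1)])
    qed
    finally show ?thesis unfolding I .
  qed
  with step show ?case by simp
qed

definition interval_pmf :: "real \<Rightarrow> int \<Rightarrow> int \<Rightarrow> config pmf" where
  "interval_pmf \<rho> a b = embed_pmf (\<lambda>\<sigma>. if \<sigma> \<in> {a..b} \<rightarrow>\<^sub>E {0, 1} then weight \<rho> a b \<sigma> else 0)"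

lemma finite_PiE01: "finite S \<Longrightarrow> finite (S \<rightarrow>\<^sub>E {0, 1::nat})"
  by (intro finite_PiE) auto

lemma pmf_interval:
  assumes \<rho>: "1/2 < \<rho>" "\<rho> < 1" and ab: "a \<le> b"
  shows "pmf (interval_pmf \<rho> a b) \<sigma> = (if \<sigma> \<in> {a..b} \<rightarrow>\<^sub>E {0, 1} then weight \<rho> a b \<sigma> else 0)"
  unfolding interval_pmf_def
proof (rule pmf_embed_pmf)
  let ?S = "{a..b} \<rightarrow>\<^sub>E {0, 1::nat}"
  let ?f = "\<lambda>\<sigma>. if \<sigma> \<in> ?S then weight \<rho> a b \<sigma> else 0"
  show nn: "0 \<le> ?f \<sigma>" for \<sigma> using weight_nonneg[OF \<rho>] by simp
  have "(\<integral>\<^sup>+\<sigma>. ennreal (?f \<sigma>) \<partial>count_space UNIV) = (\<Sum>\<sigma>\<in>?S. ennreal (?f \<sigma>))"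
    by (rule nn_integral_count_space') (auto intro!: finite_PiE01 simp del: One_nat_def)
  also have "\<dots> = ennreal (\<Sum>\<sigma>\<in>?S. weight \<rho> a b \<sigma>)"
    using weight_nonneg[OF \<rho>] by (subst sum_ennreal[symmetric]) auto
  finally show "(\<integral>\<^sup>+\<sigma>. ennreal (?f \<sigma>) \<partial>count_space UNIV) = 1"
    using weight_sum[OF \<rho> ab] by simp
qed

lemma set_interval_pmf:
  assumes \<rho>: "1/2 < \<rho>" "\<rho> < 1" and ab: "a \<le> b"
  shows "set_pmf (interval_pmf \<rho> a b) \<subseteq> {a..b} \<rightarrow>\<^sub>E {0, 1}"
  by (auto simp: set_pmf_eq pmf_interval[OF assms])

lemma interval_pmf_restrict_aux:
  assumes \<rho>: "1/2 < \<rho>" "\<rho> < 1" and ab: "a \<le> b" "c \<le> d"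
    and I: "{c..d} = insert i {a..b}" "i \<notin> {a..b}"
    and w: "\<And>\<tau>. \<tau> \<in> {a..b} \<rightarrow>\<^sub>E {0, 1} \<Longrightarrow>
      weight \<rho> c d (\<tau>(i := 0)) + weight \<rho> c d (\<tau>(i := 1)) = weight \<rho> a b \<tau>"
  shows "map_pmf (\<lambda>\<omega>. restrict \<omega> {a..b}) (interval_pmf \<rho> c d) = interval_pmf \<rho> a b"
proof (rule pmf_eqI)
  fix \<tau> :: config
  let ?Q = "interval_pmf \<rho> c d" and ?r = "\<lambda>\<omega>::config. restrict \<omega> {a..b}"
  have S: "set_pmf ?Q \<subseteq> {c..d} \<rightarrow>\<^sub>E {0, 1}" using set_interval_pmf[OF \<rho> ab(2)] .
  have "pmf (map_pmf ?r ?Q) \<tau> = measure ?Q (?r -` {\<tau>} \<inter> ({c..d} \<rightarrow>\<^sub>E {0, 1}))"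
    unfolding pmf_map using S by (intro measure_pmf.finite_measure_eq_AE) (simp_all add: AE_measure_pmf_iff subset_iff)
  also have "\<dots> = pmf (interval_pmf \<rho> a b) \<tau>"
  proof (cases "\<tau> \<in> {a..b} \<rightarrow>\<^sub>E {0, 1}")
    case True
    have "?r -` {\<tau>} \<inter> ({c..d} \<rightarrow>\<^sub>E {0, 1}) = {\<tau>(i := 0), \<tau>(i := 1)}" (is "?L = ?R")
    proof
      show "?L \<subseteq> ?R"
      proof
        fix \<omega> assume \<omega>: "\<omega> \<in> ?L"
        then have *: "\<omega> \<in> insert i {a..b} \<rightarrow>\<^sub>E {0, 1}" "\<tau> = ?r \<omega>" unfolding I by auto
        have "\<omega> = \<tau>(i := \<omega> i)"
          using * I(2) by (auto simp: fun_eq_iff PiE_iff extensional_def)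
        moreover have "\<omega> i \<in> {0, 1}" using * by auto
        ultimately show "\<omega> \<in> ?R" by (metis empty_iff insert_iff)
      qed
      show "?R \<subseteq> ?L"
        using True I(2) unfolding I(1) by (auto simp: fun_eq_iff PiE_iff extensional_def)
    qed
    moreover have "\<tau>(i := 0) \<noteq> \<tau>(i := 1)" by (metis fun_upd_same zero_neq_one)
    ultimately have "measure ?Q (?r -` {\<tau>} \<inter> ({c..d} \<rightarrow>\<^sub>E {0, 1})) = pmf ?Q (\<tau>(i := 0)) + pmf ?Q (\<tau>(i := 1))"
      by (simp add: measure_measure_pmf_finite)
    moreover have "\<tau>(i := 0) \<in> {c..d} \<rightarrow>\<^sub>E {0, 1}" "\<tau>(i := 1) \<in> {c..d} \<rightarrow>\<^sub>E {0, 1}"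
      using True unfolding I(1) by (auto simp: PiE_iff extensional_def)
    ultimately show ?thesis
      using True w[OF True] by (simp add: pmf_interval[OF \<rho> ab(2)] pmf_interval[OF \<rho> ab(1)])
  next
    case False
    have "?r -` {\<tau>} \<inter> ({c..d} \<rightarrow>\<^sub>E {0, 1}) = {}"
    proof (rule ccontr)
      assume "\<not> ?thesis"
      then obtain \<omega> where "\<omega> \<in> insert i {a..b} \<rightarrow>\<^sub>E {0, 1}" "\<tau> = restrict \<omega> {a..b}" unfolding I(1) by blast
      then have "\<tau> \<in> {a..b} \<rightarrow>\<^sub>E {0, 1}" by (simp only: restrict_PiE_iff) (blast dest: PiE_mem)
      with False show False by blast
    qed
    then show ?thesis using False by (simp add: pmf_interval[OF \<rho> ab(1)])
  qed
  finally show "pmf (map_pmf ?r ?Q) \<tau> = pmf (interval_pmf \<rho> a b) \<tau>" .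
qed

lemma interval_pmf_restrict:
  assumes \<rho>: "1/2 < \<rho>" "\<rho> < 1" and ab: "a \<le> b" and cd: "c \<le> a" "b \<le> d"
  shows "map_pmf (\<lambda>\<omega>. restrict \<omega> {a..b}) (interval_pmf \<rho> c d) = interval_pmf \<rho> a b"
proof -
  have 1: "map_pmf (\<lambda>\<omega>. restrict \<omega> {a..b}) (interval_pmf \<rho> a d) = interval_pmf \<rho> a b"
    using cd(2)
  proof (induction d rule: int_ge_induct)
    case base
    have "map_pmf (\<lambda>\<omega>. restrict \<omega> {a..b}) (interval_pmf \<rho> a b) = map_pmf (\<lambda>\<omega>. \<omega>) (interval_pmf \<rho> a b)"
    proof (intro map_pmf_cong refl)
      fix \<omega> assume "\<omega> \<in> set_pmf (interval_pmf \<rho> a b)"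
      then have "\<omega> \<in> {a..b} \<rightarrow>\<^sub>E {0, 1}" using set_interval_pmf[OF \<rho> ab] by blast
      then show "restrict \<omega> {a..b} = \<omega>" by (rule PiE_restrict)
    qed
    then show ?case by (simp only: map_pmf_ident)
  next
    case (step d)
    have "map_pmf (\<lambda>\<omega>. restrict \<omega> {a..d}) (interval_pmf \<rho> a (d+1)) = interval_pmf \<rho> a d"
    proof (rule interval_pmf_restrict_aux[OF \<rho>, where i = "d+1"])
      show le: "a \<le> d" using step(1) ab by simp
      show "{a..d+1} = insert (d+1) {a..d}" using le by auto
      fix \<tau> :: config assume "\<tau> \<in> {a..d} \<rightarrow>\<^sub>E {0, 1}"
      then have "\<tau> d \<in> {0, 1}" by (rule PiE_mem) (use le in simp)
      then show "weight \<rho> a (d+1) (\<tau>(d+1 := 0)) + weight \<rho> a (d+1) (\<tau>(d+1 := 1)) = weight \<rho> a d \<tau>"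
        by (rule weight_right[OF \<rho> le])
    qed (use step(1) ab in auto)
    then have "map_pmf (\<lambda>\<omega>. restrict \<omega> {a..b}) (map_pmf (\<lambda>\<omega>. restrict \<omega> {a..d}) (interval_pmf \<rho> a (d+1)))
        = interval_pmf \<rho> a b" using step(2) by (simp only:)
    moreover have "{a..d} \<inter> {a..b} = {a..b}" using step(1) by auto
    ultimately show ?case by (simp only: pmf.map_comp o_def restrict_restrict)
  qed
  show ?thesis using cd(1)
  proof (induction c rule: int_le_induct)
    case base
    show ?case by (rule 1)
  next
    case (step c)
    have "map_pmf (\<lambda>\<omega>. restrict \<omega> {c..d}) (interval_pmf \<rho> (c-1) d) = interval_pmf \<rho> c d"
    proof (rule interval_pmf_restrict_aux[OF \<rho>, where i = "c-1"])
      show le: "c \<le> d" using step(1) ab cd by simp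
      show "{c-1..d} = insert (c-1) {c..d}" using le by auto
      fix \<tau> :: config assume "\<tau> \<in> {c..d} \<rightarrow>\<^sub>E {0, 1}"
      then have "\<tau> c \<in> {0, 1}" by (rule PiE_mem) (use le in simp)
      then show "weight \<rho> (c-1) d (\<tau>(c-1 := 0)) + weight \<rho> (c-1) d (\<tau>(c-1 := 1)) = weight \<rho> c d \<tau>"
        by (rule weight_left[OF \<rho> le])
    qed (use step(1) ab cd in auto)
    then have "map_pmf (\<lambda>\<omega>. restrict \<omega> {a..b}) (map_pmf (\<lambda>\<omega>. restrict \<omega> {c..d}) (interval_pmf \<rho> (c-1) d))
        = interval_pmf \<rho> a b" using step(2) by (simp only:)
    moreover have "{c..d} \<inter> {a..b} = {a..b}" using step(1) cd by auto
    ultimately show ?case by (simp only: pmf.map_comp o_def restrict_restrict)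
  qed
qed

lemma space_config_space: "space config_space = UNIV \<rightarrow>\<^sub>E {0, 1}"
  by (simp add: config_space_def space_PiM)

lemma restrict_eq_restrict_iff: "restrict f S = restrict g S \<longleftrightarrow> (\<forall>x\<in>S. f x = g x)"
  by (metis restrict_apply' restrict_ext)

lemma cylinder_sets:
  assumes "finite S" "sets M = sets config_space"
  shows "{\<eta> \<in> space M. \<forall>x\<in>S. \<eta> (x + y) = \<sigma> x} \<in> sets M"
proof -
  have "(\<lambda>\<eta>. \<eta> (x + y)) \<in> config_space \<rightarrow>\<^sub>M count_space {0, 1}" for x
    unfolding config_space_def by simp
  then have "(\<lambda>\<eta>. \<eta> (x + y)) -` ({\<sigma> x} \<inter> {0, 1}) \<inter> space config_space \<in> sets config_space" for x
    by (rule measurable_sets) auto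
  moreover have "(\<lambda>\<eta>. \<eta> (x + y)) -` ({\<sigma> x} \<inter> {0, 1}) \<inter> space config_space
      = {\<eta> \<in> space config_space. \<eta> (x + y) = \<sigma> x}" for x
    unfolding space_config_space by (auto dest: PiE_mem simp del: One_nat_def)
  ultimately have "{\<eta> \<in> space config_space. \<eta> (x + y) = \<sigma> x} \<in> sets config_space" for x
    by simp
  then have "{\<eta> \<in> space config_space. \<forall>x\<in>S. \<eta> (x + y) = \<sigma> x} \<in> sets config_space"
    using assms(1) by (intro sets.sets_Collect_finite_All) auto
  then show ?thesis using assms(2) sets_eq_imp_space_eq[OF assms(2)] by simp
qed

lemma config_measure_eqI:
  assumes "prob_space M" "prob_space N" "sets M = sets config_space" "sets N = sets config_space"
    and eq: "\<And>a b \<sigma>. a \<le> b \<Longrightarrow> \<sigma> \<in> {a..b} \<rightarrow>\<^sub>E {0, 1} \<Longrightarrow>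
      \<P>(\<eta> in M. \<forall>x\<in>{a..b}. \<eta> x = \<sigma> x) = \<P>(\<eta> in N. \<forall>x\<in>{a..b}. \<eta> x = \<sigma> x)"
  shows "M = N"
proof (rule measure_eqI_PiM_infinite)
  show "sets M = sets (Pi\<^sub>M UNIV (\<lambda>_. count_space {0, 1}))" "sets N = sets (Pi\<^sub>M UNIV (\<lambda>_. count_space {0, 1}))"
    using assms by (simp_all add: config_space_def)
  show "finite_measure M" using assms(1) by (rule prob_space.finite_measure)
  fix J :: "int set" and A :: "int \<Rightarrow> nat set"
  assume J: "finite J"
  define n where "n = Max (insert 0 (abs ` J))"
  have n: "J \<subseteq> {-n..n}" "-n \<le> n"
  proof -
    have "\<bar>x\<bar> \<le> n" if "x \<in> J" for x using J that by (auto simp: n_def)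
    then show "J \<subseteq> {-n..n}" by (force simp: abs_le_iff)
    have "0 \<le> n" using J by (auto simp: n_def)
    then show "-n \<le> n" by simp
  qed
  define T where "T = {\<sigma> \<in> {-n..n} \<rightarrow>\<^sub>E {0, 1::nat}. \<forall>j\<in>J. \<sigma> j \<in> A j}"
  define c where "c \<sigma> = {\<eta> \<in> space config_space. \<forall>x\<in>{-n..n}. \<eta> x = \<sigma> x}" for \<sigma> :: config
  let ?X = "prod_emb UNIV (\<lambda>_. count_space {0, 1::nat}) J (Pi\<^sub>E J A)"
  have fT: "finite T" unfolding T_def by (rule finite_subset[OF _ finite_PiE01[of "{-n..n}"]]) auto
  have dj: "disjoint_family_on c T"
  proof -
    have "\<sigma> = \<tau>" if "\<sigma> \<in> T" "\<tau> \<in> T" "\<eta> \<in> c \<sigma>" "\<eta> \<in> c \<tau>" for \<sigma> \<tau> \<eta>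
    proof (rule PiE_ext)
      show "\<sigma> \<in> {-n..n} \<rightarrow>\<^sub>E {0, 1}" "\<tau> \<in> {-n..n} \<rightarrow>\<^sub>E {0, 1}" using that by (auto simp: T_def)
      show "\<sigma> x = \<tau> x" if "x \<in> {-n..n}" for x
        using that \<open>\<eta> \<in> c \<sigma>\<close> \<open>\<eta> \<in> c \<tau>\<close> unfolding c_def by auto
    qed
    then show ?thesis unfolding disjoint_family_on_def by blast
  qed
  have X: "?X = (\<Union>\<sigma>\<in>T. c \<sigma>)"
  proof (intro equalityI subsetI)
    fix \<eta> assume \<eta>: "\<eta> \<in> ?X"
    then have s: "\<eta> \<in> space config_space" and A: "\<forall>j\<in>J. \<eta> j \<in> A j"
      by (auto simp: prod_emb_def space_config_space PiE_iff)
    have "restrict \<eta> {-n..n} \<in> T" using s A n unfolding T_def space_config_space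
      by (auto simp: PiE_iff subset_iff)
    moreover have "\<eta> \<in> c (restrict \<eta> {-n..n})" using s by (simp add: c_def)
    ultimately show "\<eta> \<in> (\<Union>\<sigma>\<in>T. c \<sigma>)" by blast
  next
    fix \<eta> assume "\<eta> \<in> (\<Union>\<sigma>\<in>T. c \<sigma>)"
    then obtain \<sigma> where \<sigma>: "\<sigma> \<in> T" "\<eta> \<in> c \<sigma>" by blast
    have "\<eta> j \<in> A j" if "j \<in> J" for j
    proof -
      have "\<sigma> j \<in> A j" using \<sigma>(1) that by (simp add: T_def)
      moreover have "\<eta> j = \<sigma> j" using \<sigma>(2) that n(1) unfolding c_def by blast
      ultimately show ?thesis by simp
    qed
    then show "\<eta> \<in> ?X" using \<sigma>(2) by (auto simp: prod_emb_def space_config_space c_def)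
  qed
  have *: "emeasure K ?X = (\<Sum>\<sigma>\<in>T. ennreal (\<P>(\<eta> in K. \<forall>x\<in>{-n..n}. \<eta> x = \<sigma> x)))"
    if K: "prob_space K" "sets K = sets config_space" for K
  proof -
    interpret prob_space K by fact
    have sp: "space K = space config_space" using K(2) by (rule sets_eq_imp_space_eq)
    have c: "c \<sigma> = {\<eta> \<in> space K. \<forall>x\<in>{-n..n}. \<eta> x = \<sigma> x}" for \<sigma> by (simp add: c_def sp)
    have "c \<sigma> \<in> sets K" for \<sigma>
      using cylinder_sets[OF _ K(2), of "{-n..n}" 0 \<sigma>] by (simp add: c)
    then have "emeasure K ?X = (\<Sum>\<sigma>\<in>T. emeasure K (c \<sigma>))"
      unfolding X using fT dj by (intro sum_emeasure[symmetric]) auto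
    then show ?thesis by (simp add: emeasure_eq_measure c)
  qed
  show "emeasure M ?X = emeasure N ?X"
    unfolding *[OF assms(1,3)] *[OF assms(2,4)]
    using eq[OF n(2)] by (intro sum.cong) (auto simp: T_def)
qed

lemma shift_measurable: "(\<lambda>\<eta> x. \<eta> (x + y)) \<in> config_space \<rightarrow>\<^sub>M config_space"
  unfolding config_space_def by (rule measurable_PiM_single') (auto simp: space_PiM PiE_iff)

lemma equilibrium_cylinder:
  assumes M: "is_equilibrium \<rho> M" and ab: "a \<le> b" and \<sigma>: "\<sigma> \<in> {a..b} \<rightarrow>\<^sub>E {0, 1}"
  shows "\<P>(\<eta> in M. \<forall>x\<in>{a..b}. \<eta> x = \<sigma> x) = weight \<rho> a b \<sigma>"
proof -
  have sM: "sets M = sets config_space" and inv: "distr M config_space (\<lambda>\<eta> x. \<eta> (x + (1 - a))) = M"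
    using M by (auto simp: is_equilibrium_def)
  have spM: "space M = space config_space" using sM by (rule sets_eq_imp_space_eq)
  define m where "m = nat (b - a + 1)"
  have m: "m \<ge> 1" "int m = b - a + 1" using ab by (auto simp: m_def)
  define \<tau> where "\<tau> = restrict (\<lambda>x. \<sigma> (x + (a - 1))) {1..int m}"
  have \<tau>: "\<tau> \<in> {1..int m} \<rightarrow>\<^sub>E {0, 1}"
    unfolding \<tau>_def restrict_PiE_iff
  proof
    fix x assume "x \<in> {1..int m}"
    then have "x + (a - 1) \<in> {a..b}" using m by auto
    then show "\<sigma> (x + (a - 1)) \<in> {0, 1}" by (rule PiE_mem[OF \<sigma>])
  qed
  have meas: "(\<lambda>\<eta> x. \<eta> (x + (1 - a))) \<in> M \<rightarrow>\<^sub>M config_space"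
    using shift_measurable by (simp add: measurable_cong_sets[OF sM refl])
  have shift: "(\<forall>x\<in>{a..b}. \<eta> (x + (1 - a)) = \<sigma> x) \<longleftrightarrow> restrict \<eta> {1..int m} = \<tau>" for \<eta> :: config
  proof
    assume *: "\<forall>x\<in>{a..b}. \<eta> (x + (1 - a)) = \<sigma> x"
    show "restrict \<eta> {1..int m} = \<tau>"
    proof
      fix x show "restrict \<eta> {1..int m} x = \<tau> x"
        using *[rule_format, of "x + (a - 1)"] m by (auto simp: \<tau>_def)
    qed
  next
    assume "restrict \<eta> {1..int m} = \<tau>"
    then have *: "restrict \<eta> {1..int m} x = \<tau> x" for x by simp
    show "\<forall>x\<in>{a..b}. \<eta> (x + (1 - a)) = \<sigma> x"
    proof
      fix x assume "x \<in> {a..b}"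
      then show "\<eta> (x + (1 - a)) = \<sigma> x" using *[of "x + (1 - a)"] m by (auto simp: \<tau>_def)
    qed
  qed
  let ?C = "{\<eta> \<in> space config_space. \<forall>x\<in>{a..b}. \<eta> x = \<sigma> x}"
  have "\<P>(\<eta> in M. \<forall>x\<in>{a..b}. \<eta> x = \<sigma> x) = measure (distr M config_space (\<lambda>\<eta> x. \<eta> (x + (1 - a)))) ?C"
    by (simp add: inv spM)
  also have "\<dots> = measure M ((\<lambda>\<eta> x. \<eta> (x + (1 - a))) -` ?C \<inter> space M)"
    using cylinder_sets[of "{a..b}" config_space 0 \<sigma>] by (intro measure_distr meas) simp
  also have "(\<lambda>\<eta> x. \<eta> (x + (1 - a))) -` ?C \<inter> space M = {\<eta> \<in> space M. restrict \<eta> {1..int m} = \<tau>}"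
    using measurable_space[OF meas] by (auto simp: shift[symmetric])
  also have "measure M \<dots> = cylinder_prob \<rho> m \<tau>"
    using M m(1) \<tau> by (simp add: is_equilibrium_def)
  also have "\<dots> = weight \<rho> 1 (int m) (\<lambda>x. \<sigma> (x + (a - 1)))"
    unfolding cylinder_prob_eq_weight using m by (intro weight_cong) (auto simp: \<tau>_def)
  also have "\<dots> = weight \<rho> a b \<sigma>"
    unfolding weight_shift[symmetric] using m by simp
  finally show ?thesis .
qed

lemma equilibrium_unique:
  assumes "is_equilibrium \<rho> M" "is_equilibrium \<rho> N"
  shows "M = N"
  using assms equilibrium_cylinder[OF assms(1)] equilibrium_cylinder[OF assms(2)]
  by (intro config_measure_eqI) (auto simp: is_equilibrium_def)

definition radius :: "int set \<Rightarrow> int" where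
  "radius J = Max (insert 0 (abs ` J))"

lemma radius: "finite J \<Longrightarrow> 0 \<le> radius J" "finite J \<Longrightarrow> J \<subseteq> {- radius J..radius J}"
proof -
  assume J: "finite J"
  then show "0 \<le> radius J" by (auto simp: radius_def)
  have "\<bar>x\<bar> \<le> radius J" if "x \<in> J" for x using J that by (auto simp: radius_def)
  then show "J \<subseteq> {- radius J..radius J}" by (force simp: abs_le_iff)
qed

text \<open>The Kolmogorov extension theorem of the library needs a Polish space with its Borel
  sets, so the marginals are first realised with values in the reals.\<close>

definition real_marginal :: "real \<Rightarrow> int set \<Rightarrow> (int \<Rightarrow> real) measure" where
  "real_marginal \<rho> J = distr (interval_pmf \<rho> (- radius J) (radius J)) (Pi\<^sub>M J (\<lambda>_. borel)) (\<lambda>\<omega>. \<lambda>i\<in>J. real (\<omega> i))"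

lemma real_marginal_eq:
  assumes \<rho>: "1/2 < \<rho>" "\<rho> < 1" and J: "J \<subseteq> {- n..n}" "finite J" "0 \<le> n"
  shows "real_marginal \<rho> J = distr (interval_pmf \<rho> (- n) n) (Pi\<^sub>M J (\<lambda>_. borel)) (\<lambda>\<omega>. \<lambda>i\<in>J. real (\<omega> i))"
proof -
  have *: "distr (interval_pmf \<rho> (- n) n) (Pi\<^sub>M J (\<lambda>_. borel)) (\<lambda>\<omega>. \<lambda>i\<in>J. real (\<omega> i)) =
      distr (interval_pmf \<rho> (- N) N) (Pi\<^sub>M J (\<lambda>_. borel)) (\<lambda>\<omega>. \<lambda>i\<in>J. real (\<omega> i))"
    if n: "J \<subseteq> {- n..n}" "0 \<le> n" "n \<le> N" for n N
  proof -
    have "interval_pmf \<rho> (- n) n = map_pmf (\<lambda>\<omega>. restrict \<omega> {- n..n}) (interval_pmf \<rho> (- N) N)"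
      using n by (subst interval_pmf_restrict[OF \<rho>]) auto
    then have "distr (interval_pmf \<rho> (- n) n) (Pi\<^sub>M J (\<lambda>_. borel)) (\<lambda>\<omega>. \<lambda>i\<in>J. real (\<omega> i))
      = distr (distr (interval_pmf \<rho> (- N) N) (count_space UNIV) (\<lambda>\<omega>. restrict \<omega> {- n..n}))
          (Pi\<^sub>M J (\<lambda>_. borel)) (\<lambda>\<omega>. \<lambda>i\<in>J. real (\<omega> i))"
      by (simp add: map_pmf_rep_eq)
    also have "\<dots> = distr (interval_pmf \<rho> (- N) N) (Pi\<^sub>M J (\<lambda>_. borel))
        ((\<lambda>\<omega>. \<lambda>i\<in>J. real (\<omega> i)) \<circ> (\<lambda>\<omega>. restrict \<omega> {- n..n}))"
      by (intro distr_distr) (auto simp: space_PiM)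
    also have "(\<lambda>\<omega>. \<lambda>i\<in>J. real (\<omega> i)) \<circ> (\<lambda>\<omega>. restrict \<omega> {- n..n}) = (\<lambda>\<omega>. \<lambda>i\<in>J. real (\<omega> i))"
      using n(1) by (auto simp: fun_eq_iff restrict_def)
    finally show ?thesis .
  qed
  show ?thesis
    using *[of "radius J" "max n (radius J)"] *[of n "max n (radius J)"] J radius[OF J(2)]
    by (simp add: real_marginal_def)
qed

lemma polish_real_marginal:
  assumes \<rho>: "1/2 < \<rho>" "\<rho> < 1"
  shows "polish_projective UNIV (real_marginal \<rho>)"
proof (intro polish_projective.intro projective_family.intro)
  fix J H :: "int set" assume JH: "J \<subseteq> H" "finite H"
  then have J: "finite J" by (metis finite_subset)
  have "real_marginal \<rho> J = distr (interval_pmf \<rho> (- radius H) (radius H)) (Pi\<^sub>M J (\<lambda>_. borel)) (\<lambda>\<omega>. \<lambda>i\<in>J. real (\<omega> i))"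
    using JH J radius[OF JH(2)] by (intro real_marginal_eq[OF \<rho>]) auto
  also have "(\<lambda>\<omega>. \<lambda>i\<in>J. real (\<omega> i)) = (\<lambda>f. restrict f J) \<circ> (\<lambda>\<omega>. \<lambda>i\<in>H. real (\<omega> i))"
    using JH(1) by (auto simp: fun_eq_iff restrict_def)
  also have "distr (interval_pmf \<rho> (- radius H) (radius H)) (Pi\<^sub>M J (\<lambda>_. borel)) \<dots>
      = distr (real_marginal \<rho> H) (Pi\<^sub>M J (\<lambda>_. borel)) (\<lambda>f. restrict f J)"
    unfolding real_marginal_def using JH(1)
    by (intro distr_distr[symmetric] measurable_restrict_subset) (auto simp: space_PiM)
  finally show "real_marginal \<rho> J = distr (real_marginal \<rho> H) (Pi\<^sub>M J (\<lambda>_. borel)) (\<lambda>f. restrict f J)" .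
next
  fix J :: "int set" assume "finite J"
  show "prob_space (real_marginal \<rho> J)" unfolding real_marginal_def
    by (intro prob_space.prob_space_distr measure_pmf.prob_space_axioms) (auto simp: space_PiM)
qed

lemma equilibrium_exists:
  assumes \<rho>: "1/2 < \<rho>" "\<rho> < 1"
  shows "\<exists>M. is_equilibrium \<rho> M"
proof -
  interpret polish_projective UNIV "real_marginal \<rho>" by (rule polish_real_marginal[OF \<rho>])
  define f :: "(int \<Rightarrow> real) \<Rightarrow> config" where "f = (\<lambda>\<omega> x. if \<omega> x = 1 then 1 else 0)"
  define M where "M = distr lim config_space f"
  have mf: "f \<in> lim \<rightarrow>\<^sub>M config_space"
    unfolding f_def config_space_def
  proof (rule measurable_PiM_single')
    fix i :: int
    have [measurable]: "(\<lambda>\<omega>. \<omega> i) \<in> lim \<rightarrow>\<^sub>M borel"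
      by (simp add: measurable_cong_sets[OF sets_lim refl])
    have "(\<lambda>\<omega>. if \<omega> i = 1 then 1 else 0 :: nat) \<in> lim \<rightarrow>\<^sub>M count_space UNIV" by measurable
    then show "(\<lambda>\<omega>. if \<omega> i = 1 then 1 else 0 :: nat) \<in> lim \<rightarrow>\<^sub>M count_space {0, 1}"
      by (rule measurable_count_space_extend[rotated 2]) auto
  qed (auto simp: PiE_iff)
  have pM: "prob_space M" unfolding M_def by (rule P.prob_space_distr[OF mf])
  have sM: "sets M = sets config_space" by (simp add: M_def)
  have spM: "space M = space config_space" by (simp add: M_def)
  have cyl: "\<P>(\<eta> in M. \<forall>x\<in>{a..b}. \<eta> x = \<sigma> x) = weight \<rho> a b \<sigma>"
    if ab: "a \<le> b" and \<sigma>: "\<forall>x\<in>{a..b}. \<sigma> x \<in> {0, 1}" for a b \<sigma>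
  proof -
    let ?J = "{a..b}" and ?X = "Pi\<^sub>E {a..b} (\<lambda>x. if \<sigma> x = 1 then {1} else - {1::real})"
    let ?n = "radius {a..b}"
    have n: "- ?n \<le> a" "b \<le> ?n" "- ?n \<le> ?n" using radius[of "{a..b}"] ab by auto
    have X: "?X \<in> sets (Pi\<^sub>M ?J (\<lambda>_. borel))" by (intro sets_PiM_I_finite) auto
    have "\<P>(\<eta> in M. \<forall>x\<in>?J. \<eta> x = \<sigma> x) = measure lim (f -` {\<eta> \<in> space config_space. \<forall>x\<in>?J. \<eta> x = \<sigma> x} \<inter> space lim)"
      unfolding spM unfolding M_def
      using cylinder_sets[of ?J config_space 0 \<sigma>] by (intro measure_distr mf) simp
    also have "f -` {\<eta> \<in> space config_space. \<forall>x\<in>?J. \<eta> x = \<sigma> x} \<inter> space lim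
        = prod_emb UNIV (\<lambda>_. borel) ?J ?X"
    proof -
      have "f \<omega> x = \<sigma> x \<longleftrightarrow> \<omega> x \<in> (if \<sigma> x = 1 then {1} else - {1::real})" if "x \<in> ?J" for \<omega> x
        using \<sigma>[rule_format, OF that] by (auto simp: f_def)
      moreover have "f \<omega> \<in> space config_space" for \<omega> by (simp add: space_config_space f_def PiE_UNIV_domain)
      ultimately have mem: "\<omega> \<in> f -` {\<eta> \<in> space config_space. \<forall>x\<in>?J. \<eta> x = \<sigma> x} \<longleftrightarrow> restrict \<omega> ?J \<in> ?X" for \<omega>
        unfolding restrict_PiE_iff by blast
      have sp: "space lim = UNIV" by (simp add: space_PiM PiE_UNIV_domain)
      have emb: "prod_emb UNIV (\<lambda>_. borel) ?J ?X = (\<lambda>\<omega>. restrict \<omega> ?J) -` ?X"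
        by (simp add: prod_emb_def PiE_UNIV_domain)
      show ?thesis unfolding sp emb Int_UNIV_right
      proof (rule set_eqI)
        fix \<omega>
        show "\<omega> \<in> f -` {\<eta> \<in> space config_space. \<forall>x\<in>?J. \<eta> x = \<sigma> x} \<longleftrightarrow> \<omega> \<in> (\<lambda>\<omega>. restrict \<omega> ?J) -` ?X"
          by (subst mem) (simp only: vimage_eq)
      qed
    qed
    also have "measure lim \<dots> = measure (real_marginal \<rho> ?J) ?X"
      using X by (intro measure_lim_emb) auto
    also have "\<dots> = measure (interval_pmf \<rho> (- ?n) ?n) ((\<lambda>\<omega>. \<lambda>i\<in>?J. real (\<omega> i)) -` ?X)"
      unfolding real_marginal_def using X by (subst measure_distr) (auto simp: space_PiM)
    also have "\<dots> = measure (interval_pmf \<rho> (- ?n) ?n) ((\<lambda>\<omega>. restrict \<omega> ?J) -` {restrict \<sigma> ?J})"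
    proof (intro measure_pmf.finite_measure_eq_AE)
      show "AE \<omega> in measure_pmf (interval_pmf \<rho> (- ?n) ?n).
        (\<omega> \<in> (\<lambda>\<omega>. \<lambda>i\<in>?J. real (\<omega> i)) -` ?X) = (\<omega> \<in> (\<lambda>\<omega>. restrict \<omega> ?J) -` {restrict \<sigma> ?J})"
        unfolding AE_measure_pmf_iff
      proof
        fix \<omega> assume "\<omega> \<in> set_pmf (interval_pmf \<rho> (- ?n) ?n)"
        then have "\<omega> \<in> {- ?n..?n} \<rightarrow>\<^sub>E {0, 1}" using set_interval_pmf[OF \<rho> n(3)] by blast
        then have \<omega>: "\<omega> x \<in> {0, 1}" if "x \<in> ?J" for x by (rule PiE_mem) (use that n in simp)
        have "real (\<omega> x) \<in> (if \<sigma> x = 1 then {1} else - {1::real}) \<longleftrightarrow> \<omega> x = \<sigma> x" if "x \<in> ?J" for x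
          using \<omega>[OF that] \<sigma>[rule_format, OF that] by auto
        then show "(\<omega> \<in> (\<lambda>\<omega>. \<lambda>i\<in>?J. real (\<omega> i)) -` ?X) = (\<omega> \<in> (\<lambda>\<omega>. restrict \<omega> ?J) -` {restrict \<sigma> ?J})"
          unfolding vimage_eq restrict_PiE_iff singleton_iff restrict_eq_restrict_iff by (rule ball_cong[OF refl])
      qed
    qed auto
    also have "\<dots> = pmf (map_pmf (\<lambda>\<omega>. restrict \<omega> ?J) (interval_pmf \<rho> (- ?n) ?n)) (restrict \<sigma> ?J)"
      by (simp add: pmf_map)
    also have "\<dots> = weight \<rho> a b (restrict \<sigma> ?J)"
      using \<sigma> n by (simp add: interval_pmf_restrict[OF \<rho> ab] pmf_interval[OF \<rho> ab] restrict_PiE_iff)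
    also have "\<dots> = weight \<rho> a b \<sigma>" using ab by (intro weight_cong) auto
    finally show ?thesis .
  qed
  have "is_equilibrium \<rho> M" unfolding is_equilibrium_def
  proof (intro conjI allI impI ballI)
    show "prob_space M" "sets M = sets config_space" by fact+
    fix y
    have ms: "(\<lambda>\<eta> x. \<eta> (x + y)) \<in> M \<rightarrow>\<^sub>M config_space"
      using shift_measurable by (simp add: measurable_cong_sets[OF sM refl])
    show "distr M config_space (\<lambda>\<eta> x. \<eta> (x + y)) = M"
    proof (rule config_measure_eqI)
      show "prob_space (distr M config_space (\<lambda>\<eta> x. \<eta> (x + y)))"
        by (rule prob_space.prob_space_distr[OF pM ms])
      fix a b :: int and \<sigma> :: config
      assume ab: "a \<le> b" and \<sigma>: "\<sigma> \<in> {a..b} \<rightarrow>\<^sub>E {0, 1}"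
      let ?C = "{\<eta> \<in> space config_space. \<forall>x\<in>{a..b}. \<eta> x = \<sigma> x}"
      have "\<P>(\<eta> in distr M config_space (\<lambda>\<eta> x. \<eta> (x + y)). \<forall>x\<in>{a..b}. \<eta> x = \<sigma> x)
          = measure M ((\<lambda>\<eta> x. \<eta> (x + y)) -` ?C \<inter> space M)"
        unfolding space_distr using cylinder_sets[of "{a..b}" config_space 0 \<sigma>]
        by (intro measure_distr ms) simp
      also have "(\<lambda>\<eta> x. \<eta> (x + y)) -` ?C \<inter> space M
          = {\<eta> \<in> space M. \<forall>x\<in>{a + y..b + y}. \<eta> x = \<sigma> (x - y)}"
      proof -
        have "(\<forall>x\<in>{a..b}. \<eta> (x + y) = \<sigma> x) \<longleftrightarrow> (\<forall>x\<in>{a + y..b + y}. \<eta> x = \<sigma> (x - y))" for \<eta> :: config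
        proof
          assume *: "\<forall>x\<in>{a..b}. \<eta> (x + y) = \<sigma> x"
          show "\<forall>x\<in>{a + y..b + y}. \<eta> x = \<sigma> (x - y)"
          proof
            fix x assume "x \<in> {a + y..b + y}"
            then show "\<eta> x = \<sigma> (x - y)" using *[rule_format, of "x - y"] by simp
          qed
        next
          assume *: "\<forall>x\<in>{a + y..b + y}. \<eta> x = \<sigma> (x - y)"
          show "\<forall>x\<in>{a..b}. \<eta> (x + y) = \<sigma> x"
          proof
            fix x assume "x \<in> {a..b}"
            then show "\<eta> (x + y) = \<sigma> x" using *[rule_format, of "x + y"] by simp
          qed
        qed
        then show ?thesis using measurable_space[OF ms] by auto
      qed
      also have "measure M \<dots> = weight \<rho> (a + y) (b + y) (\<lambda>x. \<sigma> (x - y))"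
      proof (rule cyl)
        show "\<forall>x\<in>{a + y..b + y}. \<sigma> (x - y) \<in> {0, 1}"
        proof
          fix x assume "x \<in> {a + y..b + y}"
          then have "x - y \<in> {a..b}" by auto
          then show "\<sigma> (x - y) \<in> {0, 1}" by (rule PiE_mem[OF \<sigma>])
        qed
      qed (use ab in simp)
      also have "\<dots> = weight \<rho> a b \<sigma>" by (simp add: weight_shift)
      also have "\<dots> = \<P>(\<eta> in M. \<forall>x\<in>{a..b}. \<eta> x = \<sigma> x)"
        using PiE_mem[OF \<sigma>] by (intro cyl[symmetric] ab) blast
      finally show "\<P>(\<eta> in distr M config_space (\<lambda>\<eta> x. \<eta> (x + y)). \<forall>x\<in>{a..b}. \<eta> x = \<sigma> x)
          = \<P>(\<eta> in M. \<forall>x\<in>{a..b}. \<eta> x = \<sigma> x)" .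
    qed (use pM sM in auto)
  next
    fix m :: nat and \<sigma> :: config
    assume m: "m \<ge> 1" and \<sigma>: "\<sigma> \<in> {1..int m} \<rightarrow>\<^sub>E {0, 1}"
    have "restrict \<eta> {1..int m} = \<sigma> \<longleftrightarrow> (\<forall>x\<in>{1..int m}. \<eta> x = \<sigma> x)" for \<eta> :: config
      using restrict_eq_restrict_iff[of \<eta> "{1..int m}" \<sigma>] PiE_restrict[OF \<sigma>] by simp
    then show "\<P>(\<eta> in M. restrict \<eta> {1..int m} = \<sigma>) = cylinder_prob \<rho> m \<sigma>"
      using cyl[of 1 "int m" \<sigma>] m PiE_mem[OF \<sigma>] by (simp add: cylinder_prob_eq_weight)
  qed
  then show ?thesis by blast
qed

theorem ex1_equilibrium: "1/2 < \<rho> \<Longrightarrow> \<rho> < 1 \<Longrightarrow> \<exists>!M. is_equilibrium \<rho> M"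
  using equilibrium_exists equilibrium_unique by blast

theorem is_equilibrium_equilibrium: "1/2 < \<rho> \<Longrightarrow> \<rho> < 1 \<Longrightarrow> is_equilibrium \<rho> (equilibrium \<rho>)"
  unfolding equilibrium_def by (rule theI') (rule ex1_equilibrium)

end

theory Submission
  imports Defs "HOL-Real_Asymp.Real_Asymp"
begin

text \<open>A configuration, extended by a particle at each end where a hole is allowed, is a word in the
  blocks \<open>10\<close> and \<open>1\<close> that is closed by a particle; with \<open>p\<close> original particles and \<open>h\<close> holes there are \<open>N = p - 1 + a\<^sub>1 + a\<^sub>2\<close> blocks, hence \<open>N choose h\<close> configurations.
  Either a given site is occupied, or it is the hole of a block \<open>10\<close>; deleting this block gives
  for the probability \<open>G\<close> of occupation the exact recursion
  \<open>G(N, h, y) = 1 - h / N * G(N - 1, h - 1, y - 1)\<close>. While \<open>h / N\<close> stays close to \<open>q < 1\<close> the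
  recursion contracts to its fixed point \<open>1 / (1 + q)\<close>, so that \<open>t\<close> steps leave an error
  \<open>q ^ t + O(t / l)\<close>. A pattern is a word of \<open>\<alpha>\<close> blocks \<open>10\<close> and \<open>\<beta>\<close> blocks \<open>1\<close> followed by a
  particle; deleting the word costs a ratio of binomial coefficients close to
  \<open>q ^ \<alpha> * (1 - q) ^ \<beta>\<close>. With \<open>q = h / p = (1 - \<rho>) / \<rho>\<close> the product of the two limits is the
  probability of the pattern at equilibrium, and \<open>t\<close> of order \<open>(ln l)\<^sup>2\<close> makes both errors
  \<open>O((ln l)\<^sup>2 / l)\<close>.\<close>

subsection \<open>Words without adjacent holes\<close>

text \<open>\<open>True\<close> is a particle and \<open>False\<close> a hole. The letters
  \<open>a\<close> and \<open>b\<close> stand for the sites just outside the word: a hole there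
  forces a particle at that end, a particle there imposes nothing.\<close>

definition hardcore_lists :: "bool \<Rightarrow> bool \<Rightarrow> nat \<Rightarrow> nat \<Rightarrow> bool list set" where
  "hardcore_lists a b p h = {xs. successively (\<or>) (a # xs @ [b]) \<and>
     count_list xs True = p \<and> count_list xs False = h}"

lemma count_list_True_False: "count_list xs True + count_list xs False = length xs"
  by (induction xs) auto

lemma length_hardcore_lists: "xs \<in> hardcore_lists a b p h \<Longrightarrow> length xs = p + h"
  using count_list_True_False[of xs] by (auto simp: hardcore_lists_def)

lemma finite_hardcore_lists [simp]: "finite (hardcore_lists a b p h)"
proof (rule finite_subset)
  show "hardcore_lists a b p h \<subseteq> {xs. set xs \<subseteq> UNIV \<and> length xs = p + h}"
    using length_hardcore_lists by auto
  show "finite {xs::bool list. set xs \<subseteq> UNIV \<and> length xs = p + h}"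
    by (rule finite_lists_length_eq) auto
qed

text \<open>Pascal's rule: after a particle the word goes on with \<open>1\<close> or with
  \<open>01\<close>. Removing this prefix leaves a word with one particle fewer that again follows a
  particle.\<close>

lemma card_hardcore_lists_True: "card (hardcore_lists True b p h) = (p + of_bool b) choose h"
proof (induction p arbitrary: h)
  case 0
  \<comment> \<open>Without particles, exclusion allows at most one hole, and this one only if the
    right boundary letter is a particle.\<close>
  have "hardcore_lists True b 0 h = (if h = 0 \<or> b \<and> h = 1 then {replicate h False} else {})"
  proof (rule set_eqI)
    fix xs
    have 1: "xs = replicate h False" if "count_list xs True = 0" "count_list xs False = h"
      using that by (intro replicate_eqI) (auto simp: count_list_0_iff count_list_True_False[of xs, symmetric] intro: ccontr)
    have 2: "count_list (replicate h False) True = 0" "count_list (replicate h False) False = h"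
      by (induction h) auto
    have 3: "successively (\<or>) (True # replicate h False @ [b]) \<longleftrightarrow> h = 0 \<or> b \<and> h = 1"
      by (cases h; cases "h - 1") (auto simp: successively_Cons)
    show "xs \<in> hardcore_lists True b 0 h \<longleftrightarrow> xs \<in> (if h = 0 \<or> b \<and> h = 1 then {replicate h False} else {})"
      using 1 2 3 unfolding hardcore_lists_def by auto
  qed
  then show ?case by (cases h) (auto simp: of_bool_def binomial_eq_0)
next
  case (Suc p)
  show ?case
  proof (cases h)
    case 0
    have "hardcore_lists True b (Suc p) 0 = Cons True ` hardcore_lists True b p 0"
    proof (rule set_eqI)
      fix xs show "xs \<in> hardcore_lists True b (Suc p) 0 \<longleftrightarrow> xs \<in> Cons True ` hardcore_lists True b p 0"
        by (cases xs; cases "hd xs") (auto simp: hardcore_lists_def)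
    qed
    then show ?thesis using Suc 0 by (simp add: card_image)
  next
    case (Suc h')
    have *: "hardcore_lists True b (Suc p) (Suc h') = Cons True ` hardcore_lists True b p (Suc h')
      \<union> (\<lambda>xs. False # True # xs) ` hardcore_lists True b p h'"
    proof (rule set_eqI)
      fix xs
      show "xs \<in> hardcore_lists True b (Suc p) (Suc h') \<longleftrightarrow> xs \<in> Cons True ` hardcore_lists True b p (Suc h')
      \<union> (\<lambda>xs. False # True # xs) ` hardcore_lists True b p h'"
      proof (cases xs)
        case Nil then show ?thesis by (auto simp: hardcore_lists_def)
      next
        case (Cons x ys)
        then show ?thesis
          by (cases x; cases ys) (auto simp: hardcore_lists_def image_iff)
      qed
    qed
    show ?thesis unfolding Suc *
      by (subst card_Un_disjoint) (auto simp: card_image inj_on_def Suc.IH)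
  qed
qed

text \<open>A hole as left boundary letter forces a particle in front, and what follows it is
  counted by \<open>card_hardcore_lists_True\<close>. The form \<open>Suc p\<close> avoids the
  truncated difference \<open>p - 1\<close>.\<close>

lemma card_hardcore_lists:
  "card (hardcore_lists a b (Suc p) h) = (p + of_bool a + of_bool b) choose h"
proof (cases a)
  case False
  have "hardcore_lists False b (Suc p) h = Cons True ` hardcore_lists True b p h"
  proof (rule set_eqI)
    fix xs show "xs \<in> hardcore_lists False b (Suc p) h \<longleftrightarrow> xs \<in> Cons True ` hardcore_lists True b p h"
      by (cases xs; cases "hd xs") (auto simp: hardcore_lists_def)
  qed
  then show ?thesis using False by (simp add: card_image card_hardcore_lists_True)
qed (simp add: card_hardcore_lists_True)

section \<open>Occurrences of a word at a given position, and the deletion recursion\<close>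

definition infix_at :: "'a list \<Rightarrow> nat \<Rightarrow> 'a list \<Rightarrow> bool" where
  "infix_at u y xs \<longleftrightarrow> (\<exists>ys zs. xs = ys @ u @ zs \<and> length ys = y)"

text \<open>The splitting in the definition suits deleting and inserting words; this letterwise form
  suits disjointness of events and the comparison with configurations.\<close>

lemma infix_at_iff_nth:
  "infix_at u y xs \<longleftrightarrow> y + length u \<le> length xs \<and> (\<forall>i<length u. xs ! (y + i) = u ! i)"
proof
  assume "infix_at u y xs"
  then show "y + length u \<le> length xs \<and> (\<forall>i<length u. xs ! (y + i) = u ! i)"
    by (auto simp: infix_at_def nth_append)
next
  assume *: "y + length u \<le> length xs \<and> (\<forall>i<length u. xs ! (y + i) = u ! i)"
  then have "take (length u) (drop y xs) = u" by (intro nth_equalityI) auto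
  then have "xs = take y xs @ u @ drop (length u) (drop y xs)" "length (take y xs) = y"
    using * by (metis append_take_drop_id, simp)
  then show "infix_at u y xs" unfolding infix_at_def by blast
qed

definition occupied_lists :: "bool \<Rightarrow> bool \<Rightarrow> nat \<Rightarrow> nat \<Rightarrow> nat \<Rightarrow> bool list set" where
  "occupied_lists a b p h y = {xs \<in> hardcore_lists a b p h. infix_at [True] y xs}"

lemma occupied_lists_subset: "occupied_lists a b p h y \<subseteq> hardcore_lists a b p h"
  by (auto simp: occupied_lists_def)

text \<open>Deleting \<open>w\<close> keeps the exclusion constraint, since the letters that become neighbours
  are separated by a particle on the right.\<close>

lemma card_delete_word:
  assumes w: "successively (\<or>) (False # w)"
  shows "card {xs \<in> hardcore_lists a b (p + count_list w True) (h + count_list w False).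
      infix_at (w @ [True]) y xs} = card (occupied_lists a b p h y)"
proof (cases "w = []")
  case False
  note w = w False
  \<comment> \<open>Both sets of words are images of \<open>Q\<close>: the letters before the word
    and those after its closing particle, which is the \<open>+ 1\<close> in the count. The fixed
    length of \<open>ys\<close> makes both maps injective.\<close>
  define Q where "Q = {(ys, zs). length ys = y \<and> successively (\<or>) (a # ys) \<and>
    successively (\<or>) (True # zs @ [b]) \<and> count_list ys True + count_list zs True + 1 = p \<and>
    count_list ys False + count_list zs False = h}"
  have w': "hd w" "successively (\<or>) w" using w by (auto simp: successively_Cons)
  \<comment> \<open>A nonempty \<open>w\<close> starts with a particle and is followed by one, so
    neither junction imposes a constraint.\<close>
  have s1: "successively (\<or>) (a # ys @ w @ True # zs @ [b]) \<longleftrightarrow>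
    successively (\<or>) (a # ys) \<and> successively (\<or>) (True # zs @ [b])" for ys zs
    using w w' by (cases "ys = []") (auto simp: successively_append_iff successively_Cons)
  have s2: "successively (\<or>) (a # ys @ True # zs @ [b]) \<longleftrightarrow>
    successively (\<or>) (a # ys) \<and> successively (\<or>) (True # zs @ [b])" for ys zs
    by (cases "ys = []") (auto simp: successively_append_iff successively_Cons)
  have "{xs \<in> hardcore_lists a b (p + count_list w True) (h + count_list w False).
      infix_at (w @ [True]) y xs} = (\<lambda>(ys, zs). ys @ w @ True # zs) ` Q"
    unfolding Q_def hardcore_lists_def infix_at_def by (auto simp: s1 image_iff)
  moreover have "inj_on (\<lambda>(ys, zs). ys @ w @ True # zs) Q"
    by (auto simp: inj_on_def Q_def)
  moreover have "occupied_lists a b p h y = (\<lambda>(ys, zs). ys @ True # zs) ` Q"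
    unfolding Q_def hardcore_lists_def occupied_lists_def infix_at_def by (auto simp: s2 image_iff)
  moreover have "inj_on (\<lambda>(ys, zs). ys @ True # zs) Q"
    by (auto simp: inj_on_def Q_def)
  ultimately show ?thesis by (simp add: card_image)
qed (simp add: occupied_lists_def)

text \<open>If site \<open>Suc y\<close> is a hole, exclusion puts \<open>101\<close> at position
  \<open>y\<close>, and deleting \<open>10\<close> leaves a smaller word that is occupied at
  \<open>y\<close>. The bound on \<open>y\<close> keeps both neighbours of the hole inside the
  word.\<close>

lemma card_occupied_rec:
  assumes y: "y < p + h"
  shows "card (occupied_lists a b (Suc p) (Suc h) (Suc y)) + card (occupied_lists a b p h y)
    = card (hardcore_lists a b (Suc p) (Suc h))"
proof -
  let ?X = "hardcore_lists a b (Suc p) (Suc h)"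
  let ?R = "{xs \<in> ?X. infix_at ([True, False] @ [True]) y xs}"
  have X: "?X = occupied_lists a b (Suc p) (Suc h) (Suc y) \<union> ?R"
  proof (intro equalityI subsetI)
    fix xs assume xs: "xs \<in> ?X"
    then have len: "length xs = Suc (Suc (p + h))" using length_hardcore_lists by fastforce
    have "Suc (Suc (Suc 0)) \<le> length (drop y xs)" using len y by simp
    then obtain u v w zs where "drop y xs = u # v # w # zs"
      by (auto simp only: Suc_le_length_iff)
    then have e: "xs = take y xs @ u # v # w # zs" by (metis append_take_drop_id)
    have ys: "length (take y xs) = y" using len y by simp
    show "xs \<in> occupied_lists a b (Suc p) (Suc h) (Suc y) \<union> ?R"
    proof (cases v)
      case True
      then have "xs = (take y xs @ [u]) @ [True] @ w # zs" "length (take y xs @ [u]) = Suc y"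
        using e ys by simp_all
      then have "infix_at [True] (Suc y) xs" unfolding infix_at_def by blast
      then show ?thesis using xs unfolding occupied_lists_def by blast
    next
      case False
      have "successively (\<or>) (a # (take y xs @ u # v # w # zs) @ [b])"
        using xs e unfolding hardcore_lists_def by simp
      then have "u" "w" using False by (auto simp: successively_append_iff successively_Cons)
      then have "xs = take y xs @ ([True, False] @ [True]) @ zs" using e False by simp
      then have "infix_at ([True, False] @ [True]) y xs" using ys unfolding infix_at_def by blast
      then show ?thesis using xs by blast
    qed
  qed (auto simp: occupied_lists_def)
  have disj: "occupied_lists a b (Suc p) (Suc h) (Suc y) \<inter> ?R = {}"
  proof -
    have False if 1: "infix_at [True] (Suc y) xs" and 2: "infix_at [True, False, True] y xs" for xs
    proof -
      have "xs ! Suc y" using 1 by (simp add: infix_at_iff_nth)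
      moreover have "\<not> xs ! (y + 1)"
        using 2[unfolded infix_at_iff_nth, THEN conjunct2, rule_format, of 1] by simp
      ultimately show False by simp
    qed
    then show ?thesis unfolding occupied_lists_def by auto
  qed
  have "finite (occupied_lists a b (Suc p) (Suc h) (Suc y))" "finite ?R"
    by (auto intro: finite_subset[OF occupied_lists_subset])
  from card_Un_disjoint[OF this disj]
  have "card ?X = card (occupied_lists a b (Suc p) (Suc h) (Suc y)) + card ?R"
    unfolding X[symmetric] .
  then show ?thesis using card_delete_word[of "[True, False]" a b p h y] by simp
qed

subsection \<open>Convergence of the block densities\<close>

lemma abs_mult_diff_le:
  fixes x y u v :: real
  assumes "\<bar>x - u\<bar> \<le> \<epsilon>" "\<bar>y - v\<bar> \<le> \<epsilon>'" "0 \<le> y" "y \<le> 1" "0 \<le> u" "u \<le> 1"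
  shows "\<bar>x * y - u * v\<bar> \<le> \<epsilon> + \<epsilon>'"
proof -
  have "x * y - u * v = (x - u) * y + u * (y - v)" by (simp add: algebra_simps)
  also have "\<bar>\<dots>\<bar> \<le> \<bar>x - u\<bar> * y + u * \<bar>y - v\<bar>"
    using assms by (intro order_trans[OF abs_triangle_ineq]) (simp add: abs_mult)
  also have "\<dots> \<le> \<bar>x - u\<bar> * 1 + 1 * \<bar>y - v\<bar>"
    using assms by (intro add_mono mult_mono) auto
  finally show ?thesis using assms by simp
qed

text \<open>The cost of deleting one block \<open>10\<close>: by absorption it is the share of holes
  among the blocks.\<close>

lemma binomial_ratio_Suc_Suc:
  assumes "m \<le> n"
  shows "real (n choose m) / real (Suc n choose Suc m) = real (Suc m) / real (Suc n)"
proof -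
  have "real (Suc n * (n choose m)) = real ((Suc n choose Suc m) * Suc m)"
    by (simp only: Suc_times_binomial_eq)
  moreover have "Suc n choose Suc m > 0" using assms by (intro zero_less_binomial) simp
  ultimately show ?thesis by (simp add: field_simps del: binomial_Suc_Suc)
qed

text \<open>The cost of deleting one block \<open>1\<close>, which keeps the number of
  holes.\<close>

lemma binomial_ratio_Suc:
  assumes "m \<le> n"
  shows "real (n choose m) / real (Suc n choose m) = 1 - real m / real (Suc n)"
proof -
  have "(Suc n - m) * (Suc n choose m) = Suc n * (n choose m)"
    using binomial_absorb_comp[of "Suc n" m] by simp
  then have "real (Suc n - m) * real (Suc n choose m) = real (Suc n) * real (n choose m)"
    by (simp only: of_nat_mult[symmetric])
  moreover have "real (Suc n - m) = real (Suc n) - real m" using assms by (intro of_nat_diff) simp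
  moreover have "Suc n choose m > 0" using assms by (intro zero_less_binomial) simp
  ultimately show ?thesis by (simp add: field_simps)
qed

text \<open>The error at step \<open>t + 1\<close> is at most \<open>q\<close> times the error at
  step \<open>t\<close> plus \<open>\<epsilon>\<close>, so the fresh errors sum to a geometric
  series. The sizes grow with \<open>t\<close> from a smallest word, which makes the recursion an
  induction without subtraction.\<close>

lemma occupied_fraction:
  fixes q \<epsilon> :: real
  defines "c a b \<equiv> of_bool a + of_bool b"
  assumes q: "0 \<le> q" "q < 1" and e: "0 \<le> \<epsilon>" and ph: "h \<le> p" "y \<le> p + h"
    and near: "\<And>s. 1 \<le> s \<Longrightarrow> s \<le> t \<Longrightarrow> \<bar>real (h + s) / real (p + s + c a b) - q\<bar> \<le> \<epsilon>"
  shows "\<bar>real (card (occupied_lists a b (Suc p + t) (h + t) (y + t)))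
      / real ((p + t + c a b) choose (h + t)) - 1 / (1 + q)\<bar> \<le> q ^ t + \<epsilon> / (1 - q)"
  using near
proof (induction t)
  case 0
  let ?x = "real (card (occupied_lists a b (Suc p) h y)) / real ((p + c a b) choose h)"
  have "card (occupied_lists a b (Suc p) h y) \<le> (p + c a b) choose h"
    using card_mono[OF finite_hardcore_lists occupied_lists_subset, of a b "Suc p" h y]
    by (simp add: card_hardcore_lists c_def add.assoc)
  then have "0 \<le> ?x" "?x \<le> 1" by (auto simp: divide_le_eq)
  moreover have "0 \<le> 1 / (1 + q)" "1 / (1 + q) \<le> 1" using q by auto
  moreover have "0 \<le> \<epsilon> / (1 - q)" using q e by auto
  \<comment> \<open>Nothing is known about the smallest word beyond the fact that both numbers lie
    in the unit interval; this is the term \<open>q ^ 0\<close>.\<close>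
  ultimately have "\<bar>?x - 1 / (1 + q)\<bar> \<le> 1 + \<epsilon> / (1 - q)" by linarith
  then show ?case by simp
next
  case (Suc t)
  define n where "n = p + t + c a b"
  define m where "m = h + t"
  define G where "G = real (card (occupied_lists a b (Suc p + t) (h + t) (y + t))) / real (n choose m)"
  have IH: "\<bar>G - 1 / (1 + q)\<bar> \<le> q ^ t + \<epsilon> / (1 - q)"
    using Suc unfolding G_def n_def m_def by simp
  have mn: "m \<le> n" using ph by (simp add: m_def n_def)
  then have pos: "n choose m > 0" "Suc n choose Suc m > 0" by auto
  have "card (occupied_lists a b (Suc p + t) (h + t) (y + t)) \<le> n choose m"
    using card_mono[OF finite_hardcore_lists occupied_lists_subset, of a b "Suc p + t" "h + t" "y + t"]
    by (simp add: card_hardcore_lists c_def n_def m_def add.assoc)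
  then have G01: "0 \<le> G" "G \<le> 1" unfolding G_def using pos by (auto simp: divide_le_eq)
  have "card (occupied_lists a b (Suc (Suc p + t)) (Suc (h + t)) (Suc (y + t)))
      + card (occupied_lists a b (Suc p + t) (h + t) (y + t)) = Suc n choose Suc m"
    using card_occupied_rec[of "y + t" "Suc p + t" "h + t" a b] ph
    by (simp add: card_hardcore_lists c_def n_def m_def add.assoc)
  then have "real (card (occupied_lists a b (Suc p + Suc t) (h + Suc t) (y + Suc t))) / real (Suc n choose Suc m)
      = 1 - G * (real (n choose m) / real (Suc n choose Suc m))"
    using pos unfolding G_def by (simp add: field_simps del: binomial_Suc_Suc)
  also have "real (n choose m) / real (Suc n choose Suc m) = real (Suc m) / real (Suc n)"
    by (rule binomial_ratio_Suc_Suc[OF mn])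
  \<comment> \<open>The fixed point equation \<open>1 / (1 + q) = 1 - q / (1 + q)\<close> separates
    the contracted old error from the error of the ratio.\<close>
  also have "1 - G * (real (Suc m) / real (Suc n)) - 1 / (1 + q)
    = q * (1 / (1 + q) - G) - G * (real (Suc m) / real (Suc n) - q)"
    using q by (simp add: field_simps)
  also have "\<bar>\<dots>\<bar> \<le> q * \<bar>G - 1 / (1 + q)\<bar> + G * \<bar>real (Suc m) / real (Suc n) - q\<bar>"
    using q G01 by (intro order_trans[OF abs_triangle_ineq4]) (simp add: abs_mult abs_minus_commute)
  also have "\<dots> \<le> q * (q ^ t + \<epsilon> / (1 - q)) + 1 * \<epsilon>"
    using q G01 IH Suc.prems[of "Suc t"] by (intro add_mono mult_mono) (auto simp: n_def m_def)
  also have "\<dots> = q ^ Suc t + \<epsilon> / (1 - q)" using q by (simp add: field_simps)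
  finally show ?case by (simp add: n_def m_def)
qed

text \<open>The quotient telescopes into one factor per deleted block, near \<open>q\<close> for a
  block \<open>10\<close> and near \<open>1 - q\<close> for a block \<open>1\<close>. All factors
  lie in the unit interval, so the errors add. In \<open>near\<close>, \<open>i\<close> counts holes
  and \<open>i'\<close> counts blocks.\<close>

lemma binomial_ratio:
  fixes q \<epsilon> :: real
  assumes q: "0 \<le> q" "q \<le> 1" and hn: "h \<le> n"
    and near: "\<And>i i'. i \<le> i' \<Longrightarrow> 1 \<le> i' \<Longrightarrow> i' \<le> r \<Longrightarrow> \<bar>real (h + i) / real (n + i') - q\<bar> \<le> \<epsilon>"
    and r: "\<alpha> + \<beta> \<le> r"
  shows "\<bar>real (n choose h) / real ((n + \<alpha> + \<beta>) choose (h + \<alpha>)) - q ^ \<alpha> * (1 - q) ^ \<beta>\<bar> \<le> real (\<alpha> + \<beta>) * \<epsilon>"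
  using r
proof (induction \<beta>)
  case 0
  then show ?case
  proof (induction \<alpha>)
    case 0
    then show ?case using hn by simp
  next
    case (Suc \<alpha>)
    let ?m = "h + \<alpha>" and ?n = "n + \<alpha>"
    have pos: "?n choose ?m > 0" using hn by auto
    have *: "real (n choose h) / real ((n + Suc \<alpha> + 0) choose (h + Suc \<alpha>))
      = real (n choose h) / real ((n + \<alpha> + 0) choose (h + \<alpha>)) * (real (Suc ?m) / real (Suc ?n))"
      using pos hn by (simp add: binomial_ratio_Suc_Suc[symmetric] del: binomial_Suc_Suc of_nat_Suc)
    have "\<bar>real (n choose h) / real ((n + \<alpha> + 0) choose (h + \<alpha>)) * (real (Suc ?m) / real (Suc ?n))
       - (q ^ \<alpha> * (1 - q) ^ 0) * q\<bar> \<le> real (\<alpha> + 0) * \<epsilon> + \<epsilon>"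
      using Suc near[of "Suc \<alpha>" "Suc \<alpha>"] q hn
      by (intro abs_mult_diff_le) (auto simp: power_le_one)
    then show ?case unfolding * by (simp add: algebra_simps)
  qed
next
  case (Suc \<beta>)
  let ?m = "h + \<alpha>" and ?n = "n + \<alpha> + \<beta>"
  have pos: "?n choose ?m > 0" using hn by auto
  have mn: "?m \<le> ?n" using hn by simp
  have *: "real (n choose h) / real ((n + \<alpha> + Suc \<beta>) choose (h + \<alpha>))
    = real (n choose h) / real (?n choose ?m) * (1 - real ?m / real (Suc ?n))"
    unfolding binomial_ratio_Suc[OF mn, symmetric] using pos by simp
  have "\<bar>real (n choose h) / real (?n choose ?m) * (1 - real ?m / real (Suc ?n))
     - (q ^ \<alpha> * (1 - q) ^ \<beta>) * (1 - q)\<bar> \<le> real (\<alpha> + \<beta>) * \<epsilon> + \<epsilon>"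
    using Suc near[of \<alpha> "Suc (\<alpha> + \<beta>)"] q hn mn
    by (intro abs_mult_diff_le) (auto simp: power_le_one mult_le_one add.assoc abs_minus_commute)
  then show ?case unfolding * by (simp add: algebra_simps)
qed

subsection \<open>Patterns\<close>

text \<open>Followed by one particle, this is \<open>u\<close> with a particle added beside each end
  that is a hole. If \<open>u\<close> ends with a particle, that one serves as the closing particle
  and is dropped here.\<close>

definition pattern_word :: "bool list \<Rightarrow> bool list" where
  "pattern_word u = (if hd u then [] else [True]) @ (if last u then butlast u else u)"

text \<open>The leading \<open>False\<close> in the first claim says that the word is empty or
  starts with a particle, as \<open>card_delete_word\<close> demands.\<close>

lemma pattern_word_properties:
  assumes u: "u \<noteq> []" "successively (\<or>) u"
  shows "successively (\<or>) (False # pattern_word u)"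
    and "count_list (pattern_word u) False = count_list u False"
    and "count_list (pattern_word u) True + of_bool (last u) = count_list u True + of_bool (\<not> hd u)"
proof -
  obtain v x where v: "u = v @ [x]" using u(1) by (metis rev_exhaust)
  show "successively (\<or>) (False # pattern_word u)"
    using u(2) unfolding pattern_word_def v
    by (cases "v = []") (auto simp: successively_append_iff successively_Cons)
  show "count_list (pattern_word u) False = count_list u False"
    "count_list (pattern_word u) True + of_bool (last u) = count_list u True + of_bool (\<not> hd u)"
    by (auto simp: pattern_word_def v)
qed

text \<open>Each hole directly follows a particle of its own, the first one possibly
  \<open>x\<close>. For \<open>x = False\<close> the difference of the two counts is thus the number
  of blocks \<open>1\<close>.\<close>

lemma count_list_False_le_True:
  "successively (\<or>) (x # w) \<Longrightarrow> count_list w False \<le> count_list w True + of_bool x"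
proof (induction w arbitrary: x)
  case (Cons y w)
  then have "count_list w False \<le> count_list w True + of_bool y" by simp
  then show ?case using Cons.prems by (cases y) auto
qed simp

text \<open>The sites next to a hole carry particles, so that a pattern can be extended to one
  that begins and ends with a particle.\<close>

lemma infix_at_pattern_word:
  assumes u: "u \<noteq> []" and xs: "successively (\<or>) xs" and y: "1 \<le> y" "y + length u < length xs"
  shows "infix_at u y xs \<longleftrightarrow> infix_at (pattern_word u @ [True]) (y - of_bool (\<not> hd u)) xs"
proof
  assume "infix_at u y xs"
  then obtain ys zs where e: "xs = ys @ u @ zs" "length ys = y" unfolding infix_at_def by blast
  \<comment> \<open>The bounds on \<open>y\<close> leave a site on either side of the pattern, so
    the neighbour of a hole at its end belongs to the word.\<close>
  have ne: "ys \<noteq> []" "zs \<noteq> []" using e y by auto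
  have s: "last ys \<or> hd u" "last u \<or> hd zs"
    using xs ne u unfolding e(1) by (auto simp: successively_append_iff)
  have "ys = (if hd u then ys else butlast ys) @ (if hd u then [] else [True])"
    using s(1) append_butlast_last_id[OF ne(1)] by (metis (full_types) append_Nil2)
  moreover have "u @ zs = (if last u then butlast u else u) @ [True] @ (if last u then zs else tl zs)"
    using s(2) append_butlast_last_id[OF u] list.collapse[OF ne(2)]
    by (metis (full_types) append.assoc append_Cons append_Nil)
  ultimately have "xs = (if hd u then ys else butlast ys) @ (pattern_word u @ [True]) @ (if last u then zs else tl zs)"
    unfolding e(1) pattern_word_def by (metis append.assoc)
  moreover have "length (if hd u then ys else butlast ys) = y - of_bool (\<not> hd u)" using e by auto
  ultimately show "infix_at (pattern_word u @ [True]) (y - of_bool (\<not> hd u)) xs"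
    unfolding infix_at_def by blast
next
  assume "infix_at (pattern_word u @ [True]) (y - of_bool (\<not> hd u)) xs"
  then obtain ys zs where e: "xs = ys @ (pattern_word u @ [True]) @ zs"
    "length ys = y - of_bool (\<not> hd u)" unfolding infix_at_def by blast
  have "(if last u then butlast u else u) @ [True] = u @ (if last u then [] else [True])"
    using append_butlast_last_id[OF u] by (metis (full_types) append_Nil2)
  then have "xs = (ys @ (if hd u then [] else [True])) @ u @ ((if last u then [] else [True]) @ zs)"
    unfolding e(1) pattern_word_def by (metis append.assoc)
  moreover have "length (ys @ (if hd u then [] else [True])) = y" using e(2) y by auto
  ultimately show "infix_at u y xs" unfolding infix_at_def by blast
qed

text \<open>Deleting \<open>w\<close> makes the fraction an exact product of a quotient
  \<open>A\<close> of binomial coefficients and an occupation probability \<open>G\<close>. The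
  hypothesis \<open>near\<close> covers both: the first \<open>t\<close> increments serve the
  recursion for \<open>G\<close>, the others the quotient \<open>A\<close>.\<close>

lemma pattern_fraction:
  fixes q \<epsilon> :: real and a b :: bool
  defines "c \<equiv> of_bool a + of_bool b"
  assumes q: "0 \<le> q" "q < 1" and ph: "h \<le> p" "y \<le> p + h"
    and w: "successively (\<or>) (False # w)"
    and near: "\<And>i i'. i \<le> i' \<Longrightarrow> i' \<le> t + count_list w True \<Longrightarrow>
      \<bar>real (h + i) / real (p + c + i') - q\<bar> \<le> \<epsilon>"
  defines "X \<equiv> hardcore_lists a b (Suc p + t + count_list w True) (h + t + count_list w False)"
  shows "\<bar>real (card {xs \<in> X. infix_at (w @ [True]) (y + t) xs}) / real (card X)
      - q ^ count_list w False * (1 - q) ^ (count_list w True - count_list w False) * (1 / (1 + q))\<bar>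
    \<le> real (count_list w True) * \<epsilon> + (q ^ t + \<epsilon> / (1 - q))"
proof -
  define r where "r = count_list w True"
  define \<alpha> where "\<alpha> = count_list w False"
  define \<beta> where "\<beta> = r - \<alpha>"
  have r: "r = \<alpha> + \<beta>" using count_list_False_le_True[OF w] by (simp add: r_def \<alpha>_def \<beta>_def)
  define n m where "n = p + t + c" and "m = h + t"
  have mn: "m \<le> n" using ph by (simp add: m_def n_def)
  have e: "0 \<le> \<epsilon>" using near[of 0 0] by linarith
  define A where "A = real (n choose m) / real ((n + \<alpha> + \<beta>) choose (m + \<alpha>))"
  define G where "G = real (card (occupied_lists a b (Suc p + t) (h + t) (y + t))) / real (n choose m)"
  have "\<bar>A - q ^ \<alpha> * (1 - q) ^ \<beta>\<bar> \<le> real (\<alpha> + \<beta>) * \<epsilon>"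
    unfolding A_def
  proof (rule binomial_ratio[where r = r])
    show "\<bar>real (m + i) / real (n + i') - q\<bar> \<le> \<epsilon>" if "i \<le> i'" "1 \<le> i'" "i' \<le> r" for i i'
      using near[of "t + i" "t + i'"] that by (simp add: n_def m_def r_def add_ac)
  qed (use q mn r in auto)
  moreover have "\<bar>G - 1 / (1 + q)\<bar> \<le> q ^ t + \<epsilon> / (1 - q)"
    using occupied_fraction[OF q e ph, of t a b] near unfolding G_def n_def m_def c_def
    by (simp add: add_ac)
  moreover have pos: "n choose m > 0" "(n + \<alpha> + \<beta>) choose (m + \<alpha>) > 0" using mn by auto
  moreover have "G \<le> 1"
    using card_mono[OF finite_hardcore_lists occupied_lists_subset, of a b "Suc p + t" "h + t" "y + t"] pos
    by (simp add: G_def card_hardcore_lists n_def m_def c_def add.assoc divide_le_eq)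
  moreover have "0 \<le> G" by (simp add: G_def)
  ultimately have "\<bar>A * G - q ^ \<alpha> * (1 - q) ^ \<beta> * (1 / (1 + q))\<bar> \<le> real r * \<epsilon> + (q ^ t + \<epsilon> / (1 - q))"
    using q r by (intro abs_mult_diff_le) (auto simp: power_le_one mult_le_one)
  moreover have "card X = (n + \<alpha> + \<beta>) choose (m + \<alpha>)"
    using card_hardcore_lists[of a b "p + t + r" "h + t + \<alpha>"] r
    by (simp add: X_def n_def m_def c_def add_ac r_def[symmetric] \<alpha>_def[symmetric])
  moreover have "card {xs \<in> X. infix_at (w @ [True]) (y + t) xs} = card (occupied_lists a b (Suc p + t) (h + t) (y + t))"
    unfolding X_def by (rule card_delete_word[OF w])
  ultimately show ?thesis using pos
    by (simp add: A_def G_def r_def[symmetric] \<alpha>_def[symmetric] \<beta>_def[symmetric])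
qed

subsection \<open>Configurations as words\<close>

lemma int_ball_eq: "int_ball 0 (real n) = {- int n..int n}"
proof (rule set_eqI)
  fix z
  show "z \<in> int_ball 0 (real n) \<longleftrightarrow> z \<in> {- int n..int n}"
    unfolding int_ball_def mem_Collect_eq atLeastAtMost_iff by linarith
qed

definition occupation_list :: "nat \<Rightarrow> config \<Rightarrow> bool list" where
  "occupation_list n \<eta> = map (\<lambda>x. \<eta> x = 1) [- int n..int n]"

lemma length_occupation_list [simp]: "length (occupation_list n \<eta>) = 2 * n + 1"
  by (simp add: occupation_list_def)

lemma nth_occupation_list:
  assumes "i < 2 * n + 1"
  shows "occupation_list n \<eta> ! i \<longleftrightarrow> \<eta> (int i - int n) = 1"
proof -
  have "- int n + int i \<le> int n" using assms by linarith
  then show ?thesis using assms by (simp add: occupation_list_def)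
qed

lemma occupation_list_ne [simp]: "occupation_list n \<eta> \<noteq> []"
  by (simp add: occupation_list_def)

lemma hd_occupation_list: "hd (occupation_list n \<eta>) \<longleftrightarrow> \<eta> (- int n) = 1"
  by (simp add: hd_conv_nth nth_occupation_list)

lemma last_occupation_list: "last (occupation_list n \<eta>) \<longleftrightarrow> \<eta> (int n) = 1"
  by (simp add: last_conv_nth nth_occupation_list)

lemma count_occupation_list:
  assumes "\<eta> \<in> {- int n..int n} \<rightarrow>\<^sub>E {0, 1}"
  shows "count_list (occupation_list n \<eta>) True = (\<Sum>x\<in>{- int n..int n}. \<eta> x)"
proof -
  have "count_list (map (\<lambda>x. \<eta> x = 1) xs) True = sum_list (map \<eta> xs)"
    if "set xs \<subseteq> {- int n..int n}" for xs
    using that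
  proof (induction xs)
    case (Cons x xs)
    moreover have "\<eta> x \<in> {0, 1}" using Cons.prems by (intro PiE_mem[OF assms]) simp
    ultimately show ?case by auto
  qed simp
  from this[of "[- int n..int n]"] show ?thesis
    by (simp add: occupation_list_def sum_list_distinct_conv_sum_set)
qed

lemma successively_occupation_list:
  assumes "\<eta> \<in> {- int n..int n} \<rightarrow>\<^sub>E {0, 1}"
  shows "successively (\<or>) (occupation_list n \<eta>) \<longleftrightarrow> ergodic {- int n..int n} \<eta>"
proof -
  have 01: "\<eta> x = 1 \<longleftrightarrow> \<eta> x \<ge> 1" if "x \<in> {- int n..int n}" for x
    using PiE_mem[OF assms that] by auto
  have "successively (\<or>) (occupation_list n \<eta>) \<longleftrightarrow>
      (\<forall>i. Suc i < 2 * n + 1 \<longrightarrow> \<eta> (int i - int n) + \<eta> (int i - int n + 1) \<ge> 1)"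
    unfolding successively_conv_nth
    using 01 by (auto simp: nth_occupation_list algebra_simps)
  also have "\<dots> \<longleftrightarrow> ergodic {- int n..int n} \<eta>"
  proof
    assume *: "\<forall>i. Suc i < 2 * n + 1 \<longrightarrow> \<eta> (int i - int n) + \<eta> (int i - int n + 1) \<ge> 1"
    show "ergodic {- int n..int n} \<eta>" unfolding ergodic_def
    proof safe
      fix x assume "x \<in> {- int n..int n}" "x + 1 \<in> {- int n..int n}"
      then show "1 \<le> \<eta> x + \<eta> (x + 1)" using *[rule_format, of "nat (x + int n)"] by simp
    qed
  next
    assume "ergodic {- int n..int n} \<eta>"
    then show "\<forall>i. Suc i < 2 * n + 1 \<longrightarrow> \<eta> (int i - int n) + \<eta> (int i - int n + 1) \<ge> 1"
      unfolding ergodic_def by auto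
  qed
  finally show ?thesis .
qed

text \<open>The conditions at the ends of the box are exclusion constraints with outer sites of
  occupation \<open>fst a\<close> and \<open>snd a\<close>, which become the boundary letters. The
  total length fixes the number of holes.\<close>

lemma occupation_list_bij:
  assumes a: "a \<in> {0, 1} \<times> {0, 1}" and ph: "p + h = 2 * l + 1"
  shows "bij_betw (occupation_list l) (canonical_configs a l (int p))
    (hardcore_lists (fst a = 1) (snd a = 1) p h)"
proof -
  let ?E = "{- int l..int l} \<rightarrow>\<^sub>E {0, 1::nat}"
  have iff: "\<eta> \<in> canonical_configs a l (int p) \<longleftrightarrow>
      occupation_list l \<eta> \<in> hardcore_lists (fst a = 1) (snd a = 1) p h" if \<eta>: "\<eta> \<in> ?E" for \<eta>
  proof -
    let ?xs = "occupation_list l \<eta>"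
    have 01: "\<eta> x \<in> {0, 1}" if "x \<in> {- int l..int l}" for x using PiE_mem[OF \<eta> that] .
    have "(\<Sum>x\<in>{- int l..int l}. int (\<eta> x)) = int (count_list ?xs True)"
      by (simp add: count_occupation_list[OF \<eta>])
    moreover have "count_list ?xs True = p \<Longrightarrow> count_list ?xs False = h"
      using count_list_True_False[of ?xs] ph by simp
    moreover have "successively (\<or>) ((fst a = 1) # ?xs @ [snd a = 1]) \<longleftrightarrow>
        ergodic {- int l..int l} \<eta> \<and> fst a + \<eta> (- int l) \<ge> 1 \<and> snd a + \<eta> (int l) \<ge> 1"
      using a 01[of "- int l"] 01[of "int l"]
      by (auto simp: successively_Cons successively_append_iff hd_occupation_list
        last_occupation_list successively_occupation_list[OF \<eta>])
    ultimately show ?thesis using \<eta>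
      unfolding canonical_configs_def ergodic_configs_def hardcore_lists_def int_ball_eq by auto
  qed
  have sub: "canonical_configs a l (int p) \<subseteq> ?E"
    by (auto simp: canonical_configs_def ergodic_configs_def int_ball_eq)
  have "inj_on (occupation_list l) ?E"
  proof (rule inj_onI)
    fix \<eta> \<eta>' assume *: "\<eta> \<in> ?E" "\<eta>' \<in> ?E" "occupation_list l \<eta> = occupation_list l \<eta>'"
    show "\<eta> = \<eta>'"
    proof (rule PiE_ext[OF *(1,2)])
      fix x assume x: "x \<in> {- int l..int l}"
      then have "(\<eta> x = 1) = (\<eta>' x = 1)" using *(3) by (simp add: occupation_list_def)
      then show "\<eta> x = \<eta>' x" using PiE_mem[OF *(1) x] PiE_mem[OF *(2) x] by auto
    qed
  qed
  then have "inj_on (occupation_list l) (canonical_configs a l (int p))" using sub by (rule inj_on_subset)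
  moreover have "occupation_list l ` canonical_configs a l (int p) =
    hardcore_lists (fst a = 1) (snd a = 1) p h" (is "?L = ?R")
  proof
    show "?L \<subseteq> ?R" using iff sub by blast
    show "?R \<subseteq> ?L"
    proof
      fix xs assume xs: "xs \<in> ?R"
      define \<eta> where "\<eta> = restrict (\<lambda>x. of_bool (xs ! nat (x + int l)) :: nat) {- int l..int l}"
      have \<eta>: "\<eta> \<in> ?E" by (auto simp: \<eta>_def)
      have "occupation_list l \<eta> = xs"
        using length_hardcore_lists[OF xs] ph
        by (intro nth_equalityI) (auto simp: nth_occupation_list \<eta>_def)
      then show "xs \<in> ?L" using xs iff[OF \<eta>] by blast
    qed
  qed
  ultimately show ?thesis unfolding bij_betw_def by blast
qed

text \<open>The window of the pattern starts at site \<open>x - k\<close>, which is letter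
  \<open>x - k + l\<close> when letters are counted from \<open>0\<close>.\<close>

lemma local_pattern_iff_infix_at:
  assumes \<sigma>: "\<sigma> \<in> {- int k..int k} \<rightarrow>\<^sub>E {0, 1}" and \<eta>: "\<eta> \<in> {- int l..int l} \<rightarrow>\<^sub>E {0, 1}"
    and x: "- int l \<le> x - int k" "x + int k \<le> int l"
  shows "local_pattern k \<sigma> x \<eta> \<longleftrightarrow>
    infix_at (occupation_list k \<sigma>) (nat (x - int k + int l)) (occupation_list l \<eta>)"
proof -
  let ?y = "nat (x - int k + int l)"
  have "infix_at (occupation_list k \<sigma>) ?y (occupation_list l \<eta>) \<longleftrightarrow>
    (\<forall>i<2 * k + 1. \<eta> (x + (int i - int k)) = 1 \<longleftrightarrow> \<sigma> (int i - int k) = 1)"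
  proof -
    have "?y + (2 * k + 1) \<le> 2 * l + 1" using x by linarith
    moreover have "occupation_list l \<eta> ! (?y + i) \<longleftrightarrow> \<eta> (x + (int i - int k)) = 1" if "i < 2 * k + 1" for i
    proof -
      have "?y + i < 2 * l + 1" "int (?y + i) - int l = x + (int i - int k)" using x that by linarith+
      then show ?thesis using nth_occupation_list[of "?y + i" l \<eta>] by (simp only:)
    qed
    ultimately show ?thesis by (simp add: infix_at_iff_nth nth_occupation_list)
  qed
  also have "\<dots> \<longleftrightarrow> (\<forall>z\<in>{- int k..int k}. \<eta> (x + z) = 1 \<longleftrightarrow> \<sigma> z = 1)"
  proof safe
    fix z assume *: "\<forall>i<2 * k + 1. \<eta> (x + (int i - int k)) = 1 \<longleftrightarrow> \<sigma> (int i - int k) = 1"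
      and z: "z \<in> {- int k..int k}"
    have "nat (z + int k) < 2 * k + 1" "int (nat (z + int k)) - int k = z" using z by auto
    then have "\<eta> (x + z) = 1 \<longleftrightarrow> \<sigma> z = 1" using * by metis
    then show "\<eta> (x + z) = 1 \<Longrightarrow> \<sigma> z = 1" "\<sigma> z = 1 \<Longrightarrow> \<eta> (x + z) = 1" by auto
  qed auto
  also have "\<dots> \<longleftrightarrow> (\<forall>z\<in>{- int k..int k}. \<eta> (x + z) = \<sigma> z)"
  proof (rule ball_cong[OF refl])
    fix z assume z: "z \<in> {- int k..int k}"
    then have "x + z \<in> {- int l..int l}" using x by auto
    then show "(\<eta> (x + z) = 1 \<longleftrightarrow> \<sigma> z = 1) \<longleftrightarrow> \<eta> (x + z) = \<sigma> z"
      using PiE_mem[OF \<eta>] PiE_mem[OF \<sigma> z] by fastforce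
  qed
  finally show ?thesis by (simp add: local_pattern_def int_ball_eq)
qed

section \<open>Pattern probabilities in the two ensembles\<close>

lemma canonical_pattern_prob:
  assumes a: "a \<in> {0, 1} \<times> {0, 1}" and ph: "p + h = 2 * l + 1" "h < p"
    and \<sigma>: "\<sigma> \<in> {- int k..int k} \<rightarrow>\<^sub>E {0, 1}"
    and x: "- int l \<le> x - int k" "x + int k \<le> int l"
  defines "X \<equiv> hardcore_lists (fst a = 1) (snd a = 1) p h"
  shows "\<P>(\<eta> in canonical_measure a l (int p). local_pattern k \<sigma> x \<eta>) =
    real (card {xs \<in> X. infix_at (occupation_list k \<sigma>) (nat (x - int k + int l)) xs}) / real (card X)"
proof -
  let ?S = "canonical_configs a l (int p)"
  have bij: "bij_betw (occupation_list l) ?S X" unfolding X_def by (rule occupation_list_bij[OF a ph(1)])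
  have sub: "?S \<subseteq> {- int l..int l} \<rightarrow>\<^sub>E {0, 1}"
    by (auto simp: canonical_configs_def ergodic_configs_def int_ball_eq)
  have fin: "finite ?S" using bij_betw_finite[OF bij] by (simp add: X_def)
  obtain p' where p': "p = Suc p'" using ph(2) by (cases p) auto
  \<comment> \<open>Since \<open>h < p\<close>, the binomial coefficient is positive, so
    \<open>pmf_of_set\<close> is taken of a nonempty set and is uniform.\<close>
  have "card X > 0" using ph(2) unfolding X_def p' card_hardcore_lists by (intro zero_less_binomial) simp
  then have ne: "?S \<noteq> {}" using bij_betw_same_card[OF bij] by auto
  have "bij_betw (occupation_list l) {\<eta> \<in> ?S. local_pattern k \<sigma> x \<eta>}
    {xs \<in> X. infix_at (occupation_list k \<sigma>) (nat (x - int k + int l)) xs}"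
    using local_pattern_iff_infix_at[OF \<sigma> _ x] sub bij
    unfolding bij_betw_def inj_on_def by (auto 0 3 simp: subset_iff)
  from bij_betw_same_card[OF this]
  show ?thesis using fin ne
    by (simp add: canonical_measure_def measure_pmf_of_set bij_betw_same_card[OF bij] Int_def)
qed

text \<open>The cylinder weight rewritten in terms of the blocks of \<open>w\<close>. As
  \<open>\<rho> = 1 / (1 + q)\<close>, this is exactly the limit in
  \<open>pattern_fraction\<close>.\<close>

lemma equilibrium_pattern_prob:
  assumes \<sigma>: "\<sigma> \<in> ergodic_configs {- int k..int k}" and \<rho>: "1/2 < \<rho>" "\<rho> < 1"
  defines "w \<equiv> pattern_word (occupation_list k \<sigma>)" and "q \<equiv> (1 - \<rho>) / \<rho>"
  shows "\<P>(\<eta> in equilibrium \<rho>. local_pattern k \<sigma> 0 \<eta>) =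
    q ^ count_list w False * (1 - q) ^ (count_list w True - count_list w False) * \<rho>"
proof -
  let ?u = "occupation_list k \<sigma>"
  have \<sigma>E: "\<sigma> \<in> {- int k..int k} \<rightarrow>\<^sub>E {0, 1}" and erg: "ergodic {- int k..int k} \<sigma>"
    using \<sigma> by (auto simp: ergodic_configs_def)
  have s: "successively (\<or>) ?u" using erg by (simp add: successively_occupation_list[OF \<sigma>E])
  note pw = pattern_word_properties[OF occupation_list_ne s, folded w_def]
  have 01: "\<sigma> (- int k) \<in> {0, 1}" "\<sigma> (int k) \<in> {0, 1}"
    using PiE_mem[OF \<sigma>E, of "- int k"] PiE_mem[OF \<sigma>E, of "int k"] by simp_all
  have hl: "int (\<sigma> (- int k)) = of_bool (hd ?u)" "int (\<sigma> (int k)) = of_bool (last ?u)"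
    using 01 by (auto simp: hd_occupation_list last_occupation_list)
  have sum: "(\<Sum>x\<in>{- int k..int k}. int (\<sigma> x)) = int (count_list ?u True)"
    by (simp add: count_occupation_list[OF \<sigma>E])
  have tot: "count_list ?u True + count_list w False = 2 * k + 1"
    using count_list_True_False[of ?u] pw(2) by simp
  have le: "count_list w False \<le> count_list w True" using count_list_False_le_True[OF pw(1)] by simp
  have q: "q \<noteq> 0" "1 - q = (2 * \<rho> - 1) / \<rho>" "1 - \<rho> = \<rho> * q"
    using \<rho> by (auto simp: q_def field_simps)
  have "\<P>(\<eta> in equilibrium \<rho>. local_pattern k \<sigma> 0 \<eta>) = weight \<rho> (- int k) (int k) \<sigma>"
    using equilibrium_cylinder[OF is_equilibrium_equilibrium[OF \<rho>] _ \<sigma>E]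
    by (simp add: local_pattern_def int_ball_eq)
  also have "\<dots> = (1 - \<rho>) * q powi (int k - (- int k) - int (count_list ?u True))
      * (1 - q) powi (2 * int (count_list ?u True) - (int k - (- int k)) - of_bool (hd ?u) - of_bool (last ?u))"
    unfolding weight_def using erg by (simp only: sum hl q_def[symmetric] q(2) if_True)
  also have "int k - (- int k) - int (count_list ?u True) = int (count_list w False) - 1"
    using tot by linarith
  also have "2 * int (count_list ?u True) - (int k - (- int k)) - of_bool (hd ?u) - of_bool (last ?u)
      = int (count_list w True - count_list w False)"
    using pw(3) tot le by (auto simp: of_nat_diff split: if_splits)
  \<comment> \<open>The exponent is \<open>-1\<close> for a pattern without holes; the prefactor
    \<open>1 - \<rho> = \<rho> * q\<close> absorbs this.\<close>
  also have "(1 - \<rho>) * q powi (int (count_list w False) - 1) = q ^ count_list w False * \<rho>"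
    using q by (simp add: power_int_diff)
  finally show ?thesis by simp
qed

text \<open>Over the common denominator the numerator is \<open>h * e - d * p\<close>, at most
  \<open>2 * T * p\<close> in absolute value because \<open>h \<le> p\<close>.\<close>

lemma shifted_ratio_near:
  fixes h p d e T :: real
  assumes "0 \<le> h" "h \<le> p" "\<bar>d\<bar> \<le> T" "\<bar>e\<bar> \<le> T" "T < p"
  shows "\<bar>(h - d) / (p - e) - h / p\<bar> \<le> 2 * T / (p - T)"
proof -
  have pos: "0 < p - T" "p - T \<le> p - e" "0 < p" using assms by auto
  have "(h - d) / (p - e) - h / p = (h * e - d * p) / (p * (p - e))"
    using pos by (simp add: field_simps)
  also have "\<bar>\<dots>\<bar> = \<bar>h * e - d * p\<bar> / (p * (p - e))" using pos by simp
  also have "\<bar>h * e - d * p\<bar> \<le> h * \<bar>e\<bar> + \<bar>d\<bar> * p"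
    using assms pos by (intro order_trans[OF abs_triangle_ineq4]) (simp add: abs_mult)
  also have "\<dots> \<le> p * T + T * p" using assms by (intro add_mono mult_mono) auto
  also have "\<dots> / (p * (p - e)) = 2 * T / (p - e)" using pos by (simp add: field_simps)
  also have "\<dots> \<le> 2 * T / (p - T)" using pos assms by (intro divide_left_mono) auto
  finally show ?thesis using pos by (simp add: divide_right_mono)
qed

subsection \<open>Equivalence of ensembles\<close>

text \<open>Each step of the recursion uses up one site on either side of the pattern, hence the
  margin \<open>t + 1\<close> around the window. The bound on \<open>h / p\<close> by
  \<open>1 - \<delta>\<close> gives a uniform contraction.\<close>

lemma canonical_near_equilibrium:
  fixes k l t p h :: nat and x :: int and \<delta> :: real
  assumes \<sigma>: "\<sigma> \<in> ergodic_configs {- int k..int k}" and a: "a \<in> {0, 1} \<times> {0, 1}"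
    and \<delta>: "0 < \<delta>" "\<delta> < 1"
    and ph: "p + h = 2 * l + 1" "real h \<le> (1 - \<delta>) * real p"
    and large: "t + 2 * k + 2 \<le> h" "h + 2 * k + 3 \<le> p" "2 * (t + 2 * k + 3) \<le> p"
    and x: "- int l \<le> x - int k - 1 - int t" "x + int k + 1 + int t \<le> int l"
  defines "\<epsilon> \<equiv> 4 * real (t + 2 * k + 3) / real p"
  shows "\<bar>\<P>(\<eta> in canonical_measure a l (int p). local_pattern k \<sigma> x \<eta>)
      - \<P>(\<eta> in equilibrium (particle_density l (int p)). local_pattern k \<sigma> 0 \<eta>)\<bar>
    \<le> real (2 * k + 2) * \<epsilon> + ((1 - \<delta>) ^ t + \<epsilon> / \<delta>)"
proof -
  define u where "u = occupation_list k \<sigma>"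
  define w where "w = pattern_word u"
  define r where "r = count_list w True"
  define \<alpha> where "\<alpha> = count_list w False"
  define y where "y = nat (x - int k + int l)"
  define y' where "y' = y - of_bool (\<not> hd u)"
  define c where "c = (of_bool (fst a = 1) + of_bool (snd a = 1) :: nat)"
  define X where "X = hardcore_lists (fst a = 1) (snd a = 1) p h"
  define q where "q = real h / real p"
  have \<sigma>E: "\<sigma> \<in> {- int k..int k} \<rightarrow>\<^sub>E {0, 1}" and erg: "ergodic {- int k..int k} \<sigma>"
    using \<sigma> by (auto simp: ergodic_configs_def)
  have u: "u \<noteq> []" "successively (\<or>) u" "length u = 2 * k + 1"
    using erg by (simp_all add: u_def successively_occupation_list[OF \<sigma>E])
  note pw = pattern_word_properties[OF u(1,2), folded w_def]
  have ra: "r + \<alpha> + of_bool (last u) = 2 * k + 1 + of_bool (\<not> hd u)"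
    using pw(2,3) count_list_True_False[of u] u(3) unfolding r_def \<alpha>_def by linarith
  have ar: "\<alpha> \<le> r" using count_list_False_le_True[OF pw(1)] by (simp add: r_def \<alpha>_def)
  have \<alpha>: "\<alpha> \<le> 2 * k + 1" and r: "r \<le> 2 * k + 2"
    using ra ar by (auto simp: of_bool_def split: if_splits)
  have c: "c \<le> 2" by (auto simp: c_def)
  have b1: "of_bool (\<not> hd u) \<le> (1::nat)" "of_bool (last u) \<le> (1::nat)" by auto
  \<comment> \<open>Particles, holes and position that remain after deleting \<open>w\<close> and
    \<open>t\<close> further blocks \<open>10\<close>. The extra \<open>1\<close> in
    \<open>P\<close> is there because \<open>pattern_fraction\<close> counts particles from
    \<open>Suc P\<close>.\<close>
  define P where "P = p - 1 - t - r"
  define H where "H = h - t - \<alpha>"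
  define Y where "Y = y' - t"
  have P: "p = Suc P + t + r" using large r by (simp add: P_def)
  have H: "h = H + t + \<alpha>" using large \<alpha> by (simp add: H_def)
  have iy: "int y = x - int k + int l" using x by (simp add: y_def)
  then have y: "t + 1 \<le> y" "y + length u < 2 * l + 1" "y + 2 * k + 1 + t \<le> 2 * l" using x u(3) by linarith+
  have Y: "y' = Y + t" using y b1 unfolding Y_def y'_def by linarith
  have HP: "H \<le> P" using large r unfolding H_def P_def by linarith
  have yy: "y' + of_bool (\<not> hd u) = y" using y b1 unfolding y'_def by linarith
  have YPH: "Y \<le> P + H" using y yy ra b1 P H Y ph(1) by linarith
  have p0: "0 < p" using large by simp
  have q: "0 \<le> q" "q \<le> 1 - \<delta>" using ph(2) p0 by (auto simp: q_def divide_le_eq)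
  \<comment> \<open>All shifts of the two counts are at most \<open>T\<close>: \<open>t\<close>
    steps, up to \<open>2 * k + 2\<close> blocks of \<open>w\<close>, and one particle. Then
    \<open>2 * T \<le> p\<close> turns \<open>2 * T / (p - T)\<close> into at most
    \<open>4 * T / p\<close>.\<close>
  define T where "T = real (t + 2 * k + 3)"
  have T: "0 < T" "2 * T \<le> real p" using large(3) unfolding T_def by linarith+
  have \<epsilon>: "0 \<le> \<epsilon>" by (simp add: \<epsilon>_def)
  have \<epsilon>T: "2 * T / (real p - T) \<le> \<epsilon>"
  proof -
    have "2 * T / (real p - T) \<le> 2 * T / (real p / 2)" using T by (intro frac_le) auto
    then show ?thesis by (simp add: \<epsilon>_def T_def)
  qed
  have near: "\<bar>real (H + i) / real (P + c + i') - q\<bar> \<le> \<epsilon>" if i: "i \<le> i'" "i' \<le> t + r" for i i'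
  proof -
    define d where "d = real t + real \<alpha> - real i"
    define e where "e = 1 + real t + real r - real c - real i'"
    have "real (H + i) = real h - d" "real (P + c + i') = real p - e"
      using P H by (simp_all add: d_def e_def)
    moreover have "\<bar>d\<bar> \<le> T"
      unfolding d_def T_def abs_le_iff using i r \<alpha> by auto
    moreover have "\<bar>e\<bar> \<le> T"
      unfolding e_def T_def abs_le_iff using i r c by auto
    ultimately have "\<bar>real (H + i) / real (P + c + i') - q\<bar> \<le> 2 * T / (real p - T)"
      unfolding q_def using T large by (simp only:) (intro shifted_ratio_near, auto)
    then show ?thesis using \<epsilon>T by linarith
  qed
  have "\<P>(\<eta> in canonical_measure a l (int p). local_pattern k \<sigma> x \<eta>) =
      real (card {xs \<in> X. infix_at u y xs}) / real (card X)"
    unfolding X_def u_def y_def using x large ph by (intro canonical_pattern_prob a \<sigma>E) auto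
  also have "{xs \<in> X. infix_at u y xs} = {xs \<in> X. infix_at (w @ [True]) (Y + t) xs}"
  proof -
    have "infix_at u y xs \<longleftrightarrow> infix_at (w @ [True]) (Y + t) xs" if "xs \<in> X" for xs
    proof -
      have "successively (\<or>) xs" "length xs = 2 * l + 1"
        using that length_hardcore_lists[of xs] ph(1)
        by (auto simp: X_def hardcore_lists_def successively_Cons successively_append_iff)
      then show ?thesis
        using infix_at_pattern_word[OF u(1), of xs y] y unfolding w_def Y[symmetric] y'_def by simp
    qed
    then show ?thesis by blast
  qed
  finally have can: "\<P>(\<eta> in canonical_measure a l (int p). local_pattern k \<sigma> x \<eta>) =
    real (card {xs \<in> X. infix_at (w @ [True]) (Y + t) xs}) / real (card X)" .
  \<comment> \<open>Because \<open>p + h = 2 * l + 1\<close>, this density gives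
    \<open>(1 - \<rho>) / \<rho> = h / p\<close> exactly, so the two ensembles share the same
    \<open>q\<close>.\<close>
  define \<rho> where "\<rho> = particle_density l (int p)"
  have l: "real p + real h = 2 * real l + 1" using ph(1) by linarith
  have \<rho>': "\<rho> = real p / (real p + real h)" by (simp add: \<rho>_def particle_density_def l)
  have "h < p" "0 < h" using large by linarith+
  then have \<rho>: "1/2 < \<rho>" "\<rho> < 1" and "1 - \<rho> = real h / (real p + real h)"
    and "1 + q = (real p + real h) / real p"
    using p0 by (simp_all add: \<rho>' q_def field_simps)
  then have \<rho>q: "(1 - \<rho>) / \<rho> = q" "\<rho> = 1 / (1 + q)"
    using p0 by (simp_all add: \<rho>' q_def)
  have equ: "\<P>(\<eta> in equilibrium \<rho>. local_pattern k \<sigma> 0 \<eta>) =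
    q ^ count_list w False * (1 - q) ^ (count_list w True - count_list w False) * (1 / (1 + q))"
    using equilibrium_pattern_prob[OF \<sigma> \<rho>] \<rho>q by (simp add: w_def u_def)
  have "\<bar>\<P>(\<eta> in canonical_measure a l (int p). local_pattern k \<sigma> x \<eta>)
      - \<P>(\<eta> in equilibrium \<rho>. local_pattern k \<sigma> 0 \<eta>)\<bar> \<le> real r * \<epsilon> + (q ^ t + \<epsilon> / (1 - q))"
    unfolding can equ X_def r_def
    using pattern_fraction[OF q(1) _ HP YPH pw(1), of t "fst a = 1" "snd a = 1" \<epsilon>] near q(2) \<delta> P H
    by (simp add: c_def r_def[symmetric] \<alpha>_def[symmetric])
  also have "\<dots> \<le> real (2 * k + 2) * \<epsilon> + ((1 - \<delta>) ^ t + \<epsilon> / \<delta>)"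
    using r q \<epsilon> \<delta> by (intro add_mono mult_right_mono power_mono divide_left_mono) auto
  finally show ?thesis unfolding \<rho>_def .
qed

theorem proposition5p5:
  fixes k :: nat and \<sigma> :: config and \<delta> :: real
  assumes "\<sigma> \<in> ergodic_configs (int_ball 0 (real k))"
    and "\<delta> > 0"
  shows "\<exists>C>0. \<forall>\<^sub>F l in sequentially.
    \<forall>j\<in>particle_numbers \<delta> l. \<forall>a\<in>{0, 1} \<times> {0, 1}.
      Max ((\<lambda>x. \<bar>\<P>(\<eta> in canonical_measure a l j. local_pattern k \<sigma> x \<eta>)
                 - \<P>(\<eta> in equilibrium (particle_density l j). local_pattern k \<sigma> 0 \<eta>)\<bar>)
           ` int_ball 0 (real l - (ln (real l))\<^sup>2))
      \<le> C * (ln (real l))\<^sup>2 / real l"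
proof -
  \<comment> \<open>Below, \<open>\<epsilon>\<close> is at most \<open>8 * L / l\<close> with
    \<open>L = (ln l)^2\<close>; the \<open>1\<close> accounts for the term
    \<open>(1 - \<delta>) ^ t\<close>.\<close>
  define C where "C = 8 * real (2 * k + 2) + 8 / \<delta> + 1"
  have "0 < 8 / \<delta>" using assms(2) by simp
  then have "C > 0" unfolding C_def by linarith
  have \<delta>: "\<delta> > 0" by fact
  have "\<forall>\<^sub>F l :: nat in sequentially. 4 * real k + 6 \<le> (ln (real l))\<^sup>2" by real_asymp
  moreover have "\<forall>\<^sub>F l :: nat in sequentially. 2 * ((ln (real l))\<^sup>2 + real k + 2) \<le> real l" by real_asymp
  moreover have "\<forall>\<^sub>F l :: nat in sequentially. (ln (real l))\<^sup>2 + real k + 2 \<le> \<delta> * (real l + 1)"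
    using \<delta> by real_asymp
  \<comment> \<open>The square of the logarithm matters here: it outgrows every multiple of
    \<open>ln l\<close>, so the left side decays faster than any power of \<open>l\<close>, however
    small \<open>\<delta>\<close> is.\<close>
  moreover have "\<forall>\<^sub>F l :: nat in sequentially.
      exp (- \<delta> * ((ln (real l))\<^sup>2 - real k - 2)) \<le> (ln (real l))\<^sup>2 / real l"
    using \<delta> by real_asymp
  ultimately have "\<forall>\<^sub>F l in sequentially.
    \<forall>j\<in>particle_numbers \<delta> l. \<forall>a\<in>{0, 1} \<times> {0, 1}.
      Max ((\<lambda>x. \<bar>\<P>(\<eta> in canonical_measure a l j. local_pattern k \<sigma> x \<eta>)
                 - \<P>(\<eta> in equilibrium (particle_density l j). local_pattern k \<sigma> 0 \<eta>)\<bar>)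
           ` int_ball 0 (real l - (ln (real l))\<^sup>2))
      \<le> C * (ln (real l))\<^sup>2 / real l"
  proof (eventually_elim, intro ballI)
    fix l :: nat and j :: int and a :: "nat \<times> nat"
    define L where "L = (ln (real l))\<^sup>2"
    assume "4 * real k + 6 \<le> (ln (real l))\<^sup>2" "2 * ((ln (real l))\<^sup>2 + real k + 2) \<le> real l"
      "(ln (real l))\<^sup>2 + real k + 2 \<le> \<delta> * (real l + 1)"
      "exp (- \<delta> * ((ln (real l))\<^sup>2 - real k - 2)) \<le> (ln (real l))\<^sup>2 / real l"
      and j: "j \<in> particle_numbers \<delta> l" and a: "a \<in> {0, 1} \<times> {0, 1}"
    then have L: "4 * real k + 6 \<le> L" "2 * (L + real k + 2) \<le> real l"
      "L + real k + 2 \<le> \<delta> * (real l + 1)" "exp (- \<delta> * (L - real k - 2)) \<le> L / real l"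
      by (simp_all only: L_def)
    have j': "(real l + 1) * (1 + \<delta>) \<le> real_of_int j" "real_of_int j \<le> (2 * real l + 1) * (1 - \<delta>)"
      using j by (auto simp: particle_numbers_def)
    \<comment> \<open>A nonempty range of particle numbers forces \<open>\<delta> < 1\<close>; for
      larger \<open>\<delta>\<close> there is no \<open>j\<close> to consider.\<close>
    have "0 < (real l + 1) * (1 + \<delta>)" using \<delta> by (intro mult_pos_pos) auto
    then have "0 < (2 * real l + 1) * (1 - \<delta>)" using j' by linarith
    then have \<delta>1: "\<delta> < 1" by (simp add: zero_less_mult_iff)
    define p where "p = nat j"
    define h where "h = 2 * l + 1 - p"
    have "real_of_int j > 0" using j'(1) \<open>0 < (real l + 1) * (1 + \<delta>)\<close> by linarith
    then have jp: "j = int p" by (simp add: p_def)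
    have pl: "(real l + 1) * (1 + \<delta>) \<le> real p" "real p \<le> (2 * real l + 1) * (1 - \<delta>)"
      using j' by (simp_all add: jp)
    have m1: "0 \<le> \<delta> * real l" using \<delta> by simp
    have e: "(real l + 1) * (1 + \<delta>) = real l + \<delta> * real l + 1 + \<delta>"
      "(2 * real l + 1) * (1 - \<delta>) = 2 * real l + 1 - 2 * (\<delta> * real l) - \<delta>"
      "\<delta> * (real l + 1) = \<delta> * real l + \<delta>"
      "(1 - \<delta>) * (real l + 1) = real l + 1 - \<delta> * real l - \<delta>"
      by (simp_all add: algebra_simps)
    have "real p \<le> 2 * real l + 1" using pl(2) m1 \<delta> unfolding e by linarith
    then have ph: "p + h = 2 * l + 1" unfolding h_def by linarith
    then have hp: "real h = 2 * real l + 1 - real p" by linarith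
    \<comment> \<open>The upper end of the range of \<open>j\<close> leaves at least
      \<open>\<delta> * (2 * l + 1)\<close> holes, enough for the recursion and the pattern.\<close>
    have h1: "L + real k + 2 \<le> real h" using hp pl(2) L(3) m1 unfolding e by linarith
    have h2: "real h + 2 * real k + 3 \<le> real p"
      using hp pl(1) L(1,3) m1 unfolding e by linarith
    have h3: "real h \<le> (1 - \<delta>) * real p"
    proof -
      have "real h \<le> (1 - \<delta>) * (real l + 1)" using hp pl(1) \<delta> unfolding e by linarith
      also have "\<dots> \<le> (1 - \<delta>) * real p"
        using pl(1) \<delta> \<delta>1 m1 unfolding e(1) by (intro mult_left_mono) linarith+
      finally show ?thesis .
    qed
    have lp: "real l \<le> real p" using pl(1) m1 \<delta> unfolding e by linarith
    \<comment> \<open>The largest choice allowed by the margin: \<open>t + k + 1\<close> equals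
      \<open>\<lfloor>L\<rfloor>\<close>, and every centre \<open>x\<close> in the ball is at least
      that far from both ends of the box.\<close>
    define t where "t = nat \<lfloor>L\<rfloor> - (k + 1)"
    have fl: "int k + 1 \<le> \<lfloor>L\<rfloor>" using L(1) by linarith
    then have t: "int t = \<lfloor>L\<rfloor> - (int k + 1)" unfolding t_def by linarith
    then have tL: "real t \<le> L - real k - 1" "L - real k - 2 \<le> real t" by linarith+
    have k0: "0 \<le> real k" by simp
    have "0 < 2 * (L + real k + 2)" using L(1) k0 by argo
    also note L(2)
    finally have l0: "0 < real l" .
    have "(1 - \<delta>) ^ t \<le> exp (- \<delta>) ^ t"
      using \<delta>1 exp_ge_add_one_self[of "- \<delta>"] by (intro power_mono) auto
    also have "\<dots> = exp (- \<delta> * real t)" by (simp add: exp_of_nat_mult[symmetric] mult.commute)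
    also have "\<dots> \<le> exp (- \<delta> * (L - real k - 2))" using tL \<delta> by simp
    also have "\<dots> \<le> L / real l" by (rule L(4))
    finally have pow: "(1 - \<delta>) ^ t \<le> L / real l" .
    have "real t + 2 * real k + 2 \<le> real h" "2 * (real t + 2 * real k + 3) \<le> real p"
      using tL(1) h1 L(2) lp k0 by argo+
    then have large: "t + 2 * k + 2 \<le> h" "h + 2 * k + 3 \<le> p" "2 * (t + 2 * k + 3) \<le> p"
      using h2 by (simp_all flip: of_nat_le_iff[where 'a = real])
    define \<epsilon> where "\<epsilon> = 4 * real (t + 2 * k + 3) / real p"
    have "\<epsilon> \<le> 4 * (2 * L) / real l"
      unfolding \<epsilon>_def using tL L(1) lp l0 by (intro frac_le) auto
    then have \<epsilon>: "\<epsilon> \<le> 8 * (L / real l)" by simp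
    let ?f = "\<lambda>x. \<bar>\<P>(\<eta> in canonical_measure a l j. local_pattern k \<sigma> x \<eta>)
                 - \<P>(\<eta> in equilibrium (particle_density l j). local_pattern k \<sigma> 0 \<eta>)\<bar>"
    have bound: "?f x \<le> C * L / real l" if x: "x \<in> int_ball 0 (real l - L)" for x
    proof -
      have "real_of_int \<bar>x\<bar> \<le> real l - L" using x by (simp add: int_ball_def)
      then have "\<bar>x\<bar> \<le> int l - \<lfloor>L\<rfloor>" by linarith
      then have "- int l \<le> x - int k - 1 - int t" "x + int k + 1 + int t \<le> int l"
        using t by linarith+
      then have "?f x \<le> real (2 * k + 2) * \<epsilon> + ((1 - \<delta>) ^ t + \<epsilon> / \<delta>)"
        unfolding jp \<epsilon>_def
        by (intro canonical_near_equilibrium[OF assms(1)[unfolded int_ball_eq] a \<delta> \<delta>1 ph h3 large])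
      also have "\<dots> \<le> real (2 * k + 2) * (8 * (L / real l)) + (L / real l + 8 * (L / real l) / \<delta>)"
        using \<epsilon> pow \<delta> by (intro add_mono mult_left_mono divide_right_mono) auto
      also have "\<dots> = C * L / real l" by (simp add: C_def algebra_simps add_divide_distrib)
      finally show ?thesis .
    qed
    \<comment> \<open>\<open>Max\<close> is bounded through its elements only over a finite nonempty
      set; the centre \<open>0\<close> belongs to the ball since \<open>L \<le> l\<close>.\<close>
    have "finite (int_ball 0 (real l - L))"
    proof (rule finite_subset)
      show "int_ball 0 (real l - L) \<subseteq> {- int l..int l}"
        using L(1) int_ball_eq[of l] by (auto simp: int_ball_def)
    qed simp
    moreover have "0 \<in> int_ball 0 (real l - L)" using L(1,2) by (simp add: int_ball_def)
    ultimately show "Max (?f ` int_ball 0 (real l - (ln (real l))\<^sup>2)) \<le> C * (ln (real l))\<^sup>2 / real l"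
      unfolding L_def[symmetric] using bound by (subst Max_le_iff) auto
  qed
  with \<open>C > 0\<close> show ?thesis by blast
qed

end
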